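(* Let $a\ge 1$ be an integer and let $X\subset\{1,\ldots,a\}^{\mathbb Z}$ be a closed shift-invariant set such that the symbolic system $(X,\sigma)$ has a shift-invariant Borel probability measure $\mu$ of full support (i.e. $\mu(O)>0$ for every nonempty relatively open $O\subset X$; $\mu$ is not assumed ergodic and $X$ is not assumed infinite). Then the hub-and-spoke system $(\operatorname{Spoke}(X),\sigma)$ has completely positive mean dimension (CPMD), i.e. it has no nontrivial topological factor of zero mean dimension.
   Context: A topological dynamical system $(X,T)$ is a compact metrizable space $X$ with a homeomorphism $T:X\to X$. A factor of $(X,T)$ is a system $(Q,S)$ together with a continuous surjection $\varphi:X\to Q$ with $\varphi\circ T=S\circ\varphi$; it is nontrivial if $Q$ has more than one point. Mean dimension. For a finite open cover $\mathcal U$ of $X$, let $\operatorname{ord}(\mathcal U)=\max_{x\in X}\#\{U\in\mathcal U: x\in U\}-1$ and $\mathcal D(\mathcal U)=\min\operatorname{ord}(\gamma)$, the minimum over all finite open covers $\gamma$ of $X$ refining $\mathcal U$. Put $\mathcal U_0^{n-1}=\bigvee_{i=0}^{n-1}T^{-i}\mathcal U$ and $\operatorname{mdim}(X,T,\mathcal U)=\lim_{n\to\infty}\mathcal D(\mathcal U_0^{n-1})/n$ (the limit exists by subadditivity). Then $\operatorname{mdim}(X,T)=\sup_{\mathcal U}\operatorname{mdim}(X,T,\mathcal U)$ over all finite open covers. Shift. On any sequence space $A^{\mathbb Z}$, $\sigma$ is the left shift $(\sigma x)_m=x_{m+1}$. Hub-and-spoke system. Let $\overline{\mathbb D}$ be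 the closed unit disk in $\mathbb R^2$ and fix distinct points $p_1,\ldots,p_a\in\partial\mathbb D$. Define $\Phi:X\times[0,1]^{\mathbb Z}\to\overline{\mathbb D}^{\mathbb Z}$ by $\Phi(x,t)_i=t_i\,p_{x_i}$, and $\operatorname{Spoke}(X)=\Phi(X\times[0,1]^{\mathbb Z})$, a closed shift-invariant subset of $\overline{\mathbb D}^{\mathbb Z}$ (product topology). *)

theory Defs
  imports "HOL-Analysis.Analysis" "HOL-Probability.Probability_Measure"
begin

section \<open>Topological dynamical systems and factors\<close>

definition tds :: "'a topology \<Rightarrow> ('a \<Rightarrow> 'a) \<Rightarrow> bool" where
  "tds X T \<longleftrightarrow> compact_space X \<and> metrizable_space X \<and> homeomorphic_map X X T"

definition tds_factor ::
    "'a topology \<Rightarrow> ('a \<Rightarrow> 'a) \<Rightarrow> 'b topology \<Rightarrow> ('b \<Rightarrow> 'b) \<Rightarrow> ('a \<Rightarrow> 'b) \<Rightarrow> bool" where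
  "tds_factor X T Q S \<phi> \<longleftrightarrow>
     tds Q S \<and> continuous_map X Q \<phi> \<and> \<phi> ` topspace X = topspace Q \<and>
     (\<forall>x\<in>topspace X. \<phi> (T x) = S (\<phi> x))"


section \<open>Mean dimension\<close>

definition finite_open_cover :: "'a topology \<Rightarrow> 'a set set \<Rightarrow> bool" where
  "finite_open_cover X \<U> \<longleftrightarrow>
     finite \<U> \<and> (\<forall>U\<in>\<U>. openin X U) \<and> \<Union>\<U> = topspace X"

text \<open>The order is meaningful for a finite cover of a nonempty space; there every point lies in
  at least one member, so the subtraction on natural numbers does not truncate.\<close>

definition cover_ord :: "'a topology \<Rightarrow> 'a set set \<Rightarrow> nat" where
  "cover_ord X \<U> = Max ((\<lambda>x. card {U \<in> \<U>. x \<in> U}) ` topspace X) - 1"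

definition refines :: "'a set set \<Rightarrow> 'a set set \<Rightarrow> bool" where
  "refines \<gamma> \<U> \<longleftrightarrow> (\<forall>V\<in>\<gamma>. \<exists>U\<in>\<U>. V \<subseteq> U)"

text \<open>The infimum below is a minimum: the set of orders is a nonempty set of natural numbers,
  as \<open>\<U>\<close> refines itself.\<close>

definition cover_D :: "'a topology \<Rightarrow> 'a set set \<Rightarrow> nat" where
  "cover_D X \<U> = Inf {cover_ord X \<gamma> | \<gamma>. finite_open_cover X \<gamma> \<and> refines \<gamma> \<U>}"

definition cover_join :: "'a set set \<Rightarrow> 'a set set \<Rightarrow> 'a set set" where
  "cover_join \<U> \<V> = {U \<inter> V | U V. U \<in> \<U> \<and> V \<in> \<V>}"

definition cover_pullback :: "'a topology \<Rightarrow> ('a \<Rightarrow> 'a) \<Rightarrow> nat \<Rightarrow> 'a set set \<Rightarrow> 'a set set" where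
  "cover_pullback X T i \<U> = (\<lambda>U. {x \<in> topspace X. (T ^^ i) x \<in> U}) ` \<U>"

text \<open>\<open>cover_iter X T \<U> n\<close> is the join of \<open>T\<^sup>-\<^sup>i \<U>\<close> over \<open>0 \<le> i \<le> n - 1\<close>; the empty join is the
  trivial cover.\<close>

primrec cover_iter :: "'a topology \<Rightarrow> ('a \<Rightarrow> 'a) \<Rightarrow> 'a set set \<Rightarrow> nat \<Rightarrow> 'a set set" where
  "cover_iter X T \<U> 0 = {topspace X}"
| "cover_iter X T \<U> (Suc n) = cover_join (cover_iter X T \<U> n) (cover_pullback X T n \<U>)"

definition mdim_cover :: "'a topology \<Rightarrow> ('a \<Rightarrow> 'a) \<Rightarrow> 'a set set \<Rightarrow> real" where
  "mdim_cover X T \<U> = lim (\<lambda>n. real (cover_D X (cover_iter X T \<U> n)) / real n)"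

definition mdim :: "'a topology \<Rightarrow> ('a \<Rightarrow> 'a) \<Rightarrow> ereal" where
  "mdim X T = (SUP \<U>\<in>{\<U>. finite_open_cover X \<U>}. ereal (mdim_cover X T \<U>))"


section \<open>Completely positive mean dimension\<close>

text \<open>HOL cannot quantify over types inside a formula, so the type carrying the factors is a
  parameter; left as a type variable in a theorem, it is universally quantified there.\<close>

definition CPMD :: "'q itself \<Rightarrow> 'a topology \<Rightarrow> ('a \<Rightarrow> 'a) \<Rightarrow> bool" where
  "CPMD (_ :: 'q itself) X T \<longleftrightarrow> tds X T \<and>
     \<not> (\<exists>(Q :: 'q topology) S \<phi>. tds_factor X T Q S \<phi> \<and>
          (\<exists>x\<in>topspace Q. \<exists>y\<in>topspace Q. x \<noteq> y) \<and> mdim Q S = 0)"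


section \<open>Symbolic systems and the hub-and-spoke system\<close>

definition shift :: "(int \<Rightarrow> 'a) \<Rightarrow> int \<Rightarrow> 'a" where
  "shift x = (\<lambda>m. x (m + 1))"

definition full_shift_top :: "nat \<Rightarrow> (int \<Rightarrow> nat) topology" where
  "full_shift_top a = product_topology (\<lambda>_. discrete_topology {1..a}) UNIV"

definition disk_shift_top :: "(int \<Rightarrow> real ^ 2) topology" where
  "disk_shift_top = product_topology (\<lambda>_. top_of_set (cball 0 1)) UNIV"

definition spoke_map :: "(nat \<Rightarrow> real ^ 2) \<Rightarrow> (int \<Rightarrow> nat) \<Rightarrow> (int \<Rightarrow> real) \<Rightarrow> int \<Rightarrow> real ^ 2" where
  "spoke_map p x t = (\<lambda>i. t i *\<^sub>R p (x i))"

definition Spoke :: "(nat \<Rightarrow> real ^ 2) \<Rightarrow> (int \<Rightarrow> nat) set \<Rightarrow> (int \<Rightarrow> real ^ 2) set" where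
  "Spoke p X = {spoke_map p x t | x t. x \<in> X \<and> (\<forall>i. t i \<in> {0..1})}"

definition borel_prob_measure_on :: "'a topology \<Rightarrow> 'a measure \<Rightarrow> bool" where
  "borel_prob_measure_on X \<mu> \<longleftrightarrow>
     prob_space \<mu> \<and> space \<mu> = topspace X \<and> sets \<mu> = sets (sigma (topspace X) {U. openin X U})"

definition invariant_measure :: "'a measure \<Rightarrow> ('a \<Rightarrow> 'a) \<Rightarrow> bool" where
  "invariant_measure \<mu> T \<longleftrightarrow>
     (\<forall>A\<in>sets \<mu>. emeasure \<mu> (T -` A \<inter> space \<mu>) = emeasure \<mu> A)"

definition full_support :: "'a topology \<Rightarrow> 'a measure \<Rightarrow> bool" where
  "full_support X \<mu> \<longleftrightarrow> (\<forall>U. openin X U \<and> U \<noteq> {} \<longrightarrow> emeasure \<mu> U > 0)"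

end

theory Submission
  imports Defs
begin

text \<open>
  Points of the hub-and-spoke system that agree on a large window around the origin have images
  close to each other in a factor, and scaling contracts every point to the hub, the constant
  sequence 0. A nontrivial factor tells the hub from some \<open>y\<^sub>0\<close> that is
  supported on a finite window and lies on the spokes of a word of \<open>X\<close>. The invariant measure
  makes the word recur with positive frequency: for every \<open>n\<close> some \<open>x \<in> X\<close> shows it at least
  \<open>c n\<close> times before time \<open>n\<close>, at places with disjoint surroundings (\<open>frequent_visits\<close>,
  \<open>residue_class_pigeonhole\<close>). Over this \<open>x\<close>, copies of \<open>y\<^sub>0\<close> can be planted at these places and
  scaled independently, which maps a cube of dimension at least \<open>c n\<close> into the system and on
  into the factor.

  The cube survives in the factor. Scaling a copy by 0 or by 1 puts the image, at the time of
  that copy, near the image of the hub or near that of \<open>y\<^sub>0\<close>. A cover of the factor by two open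
  sets, each avoiding one of these neighbourhoods, thus separates opposite faces of the cube
  under the \<open>n\<close>-fold join, so by Lebesgue's covering theorem (\<open>cube_covering_theorem\<close>) every
  refinement of the join has order at least \<open>c n\<close> (\<open>cube_le_cover_D_iter\<close>). Thus the mean
  dimension of the factor is at least \<open>c\<close>.

  The last step needs that the limit which defines mean dimension exists. This comes from
  subadditivity of the dimension of covers under joins (\<open>cover_D_join_le\<close>), which has an
  elementary proof by overlaying two subdivisions of the unit interval.
\<close>

section \<open>Lebesgue covering of cubes\<close>

text \<open>The cube \<open>[0,1]\<^sup>k\<close> is needed for a \<open>k\<close> that grows with the length of the orbit segment, so \<open>k\<close>
  cannot be a type. All cubes are carried by the Hilbert cube instead; a statement about
  \<open>[0,1]\<^sup>k\<close> constrains the coordinates below \<open>k\<close> and leaves the others free.\<close>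

definition hcube :: "(nat \<Rightarrow> real) set" where
  "hcube = {s. \<forall>i. s i \<in> {0..1}}"

lemma compact_hcube: "compact hcube"
proof -
  have eq: "hcube = PiE UNIV (\<lambda>_. {0..1})"
    by (auto simp: hcube_def PiE_def Pi_def)
  have "compactin (product_topology (\<lambda>_. euclidean) UNIV) (PiE (UNIV::nat set) (\<lambda>_. {0..1::real}))"
    by (subst compactin_PiE) auto
  then show ?thesis
    by (simp add: eq euclidean_product_topology)
qed

lemma tendsto_fun_iff:
  fixes f :: "'c \<Rightarrow> 'i \<Rightarrow> 'b::topological_space"
  shows "(f \<longlongrightarrow> l) F \<longleftrightarrow> (\<forall>j. ((\<lambda>m. f m j) \<longlongrightarrow> l j) F)"
  using limitin_componentwise[of "\<lambda>_. euclidean" UNIV f l F]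
  by (simp add: euclidean_product_topology limitin_canonical_iff)

text \<open>Kuhn's combinatorial lemma, applied to the labelling that records for each \<open>i\<close> whether
  \<open>g i\<close> is below \<open>\<tau> i\<close>, finds in every grid a small box on which each \<open>g i\<close> passes \<open>\<tau> i\<close>; the boxes
  accumulate at a point where all \<open>k\<close> equations hold. Working from Kuhn's lemma rather than from
  Brouwer's theorem keeps \<open>k\<close> a natural number.\<close>

lemma poincare_miranda:
  fixes g :: "nat \<Rightarrow> (nat \<Rightarrow> real) \<Rightarrow> real"
  assumes cont: "\<And>i. i < k \<Longrightarrow> continuous_on hcube (g i)"
    and face0: "\<And>i s. \<lbrakk>i < k; s \<in> hcube; s i = 0\<rbrakk> \<Longrightarrow> g i s < \<tau> i"
    and face1: "\<And>i s. \<lbrakk>i < k; s \<in> hcube; s i = 1\<rbrakk> \<Longrightarrow> \<tau> i \<le> g i s"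
  obtains s where "s \<in> hcube" "\<And>i. i < k \<Longrightarrow> g i s = \<tau> i"
proof -
  define grid :: "nat \<Rightarrow> (nat \<Rightarrow> nat) \<Rightarrow> nat \<Rightarrow> real" where
    "grid m x = (\<lambda>j. if j < k then real (x j) / real (Suc m) else 0)" for m x
  have grid_in: "grid m x \<in> hcube" if "\<And>j. j < k \<Longrightarrow> x j \<le> Suc m" for m x
    using that by (auto simp: grid_def hcube_def divide_le_eq_1 simp del: of_nat_Suc)
  \<comment> \<open>\<open>near q r\<close>: the grid point \<open>r\<close> is a vertex of the unit box with lowest corner \<open>q\<close>.\<close>
  define near where "near q r \<longleftrightarrow> (\<forall>j<k. q j \<le> r j \<and> r j \<le> q j + 1)" for q r :: "nat \<Rightarrow> nat"
  have "\<exists>q. (\<forall>i<k. q i < Suc m) \<and>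
      (\<forall>i<k. \<exists>r s. near q r \<and> near q s \<and> g i (grid m r) < \<tau> i \<and> \<tau> i \<le> g i (grid m s))" for m
  proof -
    let ?lab = "\<lambda>x i. if g i (grid m x) < \<tau> i then 0 else (1::nat)"
    obtain q where q: "\<forall>i<k. q i < Suc m"
      "\<forall>i<k. \<exists>r s. (\<forall>j<k. q j \<le> r j \<and> r j \<le> q j + 1) \<and> (\<forall>j<k. q j \<le> s j \<and> s j \<le> q j + 1) \<and>
         ?lab r i \<noteq> ?lab s i"
    proof (rule kuhn_lemma[of "Suc m" k ?lab])
      show "\<forall>x. (\<forall>i<k. x i \<le> Suc m) \<longrightarrow> (\<forall>i<k. x i = 0 \<longrightarrow> ?lab x i = 0)"
      proof (intro allI impI)
        fix x i assume "\<forall>i<k. x i \<le> Suc m" "i < k" "x i = 0"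
        then have "g i (grid m x) < \<tau> i"
          by (intro face0 grid_in) (auto simp: grid_def)
        then show "?lab x i = 0" by simp
      qed
      show "\<forall>x. (\<forall>i<k. x i \<le> Suc m) \<longrightarrow> (\<forall>i<k. x i = Suc m \<longrightarrow> ?lab x i = 1)"
      proof (intro allI impI)
        fix x i assume "\<forall>i<k. x i \<le> Suc m" "i < k" "x i = Suc m"
        then have "\<tau> i \<le> g i (grid m x)"
          by (intro face1 grid_in) (auto simp: grid_def)
        then show "?lab x i = 1" by simp
      qed
    qed auto
    have "\<exists>r s. near q r \<and> near q s \<and> g i (grid m r) < \<tau> i \<and> \<tau> i \<le> g i (grid m s)" if i: "i < k" for i
    proof -
      obtain r s where near: "near q r" "near q s" and "?lab r i \<noteq> ?lab s i"
        using q(2) i unfolding near_def by blast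
      then consider "g i (grid m r) < \<tau> i" "\<tau> i \<le> g i (grid m s)"
        | "g i (grid m s) < \<tau> i" "\<tau> i \<le> g i (grid m r)"
        by (auto split: if_splits)
      then show ?thesis using near by cases blast+
    qed
    then show ?thesis using q(1) by blast
  qed
  then obtain q where q: "\<And>m i. i < k \<Longrightarrow> q m i < Suc m"
    and ex: "\<And>m i. i < k \<Longrightarrow> \<exists>r s. near (q m) r \<and> near (q m) s \<and>
         g i (grid m r) < \<tau> i \<and> \<tau> i \<le> g i (grid m s)"
    by metis
  have qin: "grid m (q m) \<in> hcube" for m
    using q by (intro grid_in) (simp add: less_imp_le)
  obtain s \<phi> where s: "s \<in> hcube" and \<phi>: "strict_mono (\<phi> :: nat \<Rightarrow> nat)"
      and lim: "((\<lambda>m. grid m (q m)) \<circ> \<phi>) \<longlonglongrightarrow> s"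
    using compact_hcube qin unfolding compact_eq_seq_compact_metric seq_compact_def by metis
  have lim_near: "(\<lambda>m. grid (\<phi> m) (r m)) \<longlonglongrightarrow> s"
    if r: "\<And>m. near (q (\<phi> m)) (r m)" for r
  proof -
    have "(\<lambda>m. grid (\<phi> m) (r m) j) \<longlonglongrightarrow> s j" for j
    proof -
      have l: "(\<lambda>m. grid (\<phi> m) (q (\<phi> m)) j) \<longlonglongrightarrow> s j"
        using lim unfolding tendsto_fun_iff by (simp add: o_def)
      have "(\<lambda>m. inverse (real (Suc (\<phi> m)))) \<longlonglongrightarrow> 0"
        using LIMSEQ_subseq_LIMSEQ[OF LIMSEQ_inverse_real_of_nat \<phi>] by (simp add: o_def)
      moreover have "norm (grid (\<phi> m) (r m) j - grid (\<phi> m) (q (\<phi> m)) j) \<le> inverse (real (Suc (\<phi> m)))" for m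
      proof (cases "j < k")
        case True
        then have "real (r m j) - real (q (\<phi> m) j) \<ge> 0" "real (r m j) - real (q (\<phi> m) j) \<le> 1"
          using r[of m] by (auto simp: near_def)
        then show ?thesis
          using True by (simp add: grid_def inverse_eq_divide divide_right_mono flip: diff_divide_distrib)
      qed (simp add: grid_def)
      ultimately have "(\<lambda>m. grid (\<phi> m) (r m) j - grid (\<phi> m) (q (\<phi> m)) j) \<longlonglongrightarrow> 0"
        by (intro Lim_null_comparison[OF _ \<open>(\<lambda>m. inverse (real (Suc (\<phi> m)))) \<longlonglongrightarrow> 0\<close>]) auto
      from tendsto_add[OF this l] show ?thesis by simp
    qed
    then show ?thesis unfolding tendsto_fun_iff by blast
  qed
  have "g i s = \<tau> i" if i: "i < k" for i
  proof -
    obtain r t where r: "\<And>m. near (q m) (r m)" and t: "\<And>m. near (q m) (t m)"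
      and less: "\<And>m. g i (grid m (r m)) < \<tau> i" and ge: "\<And>m. \<tau> i \<le> g i (grid m (t m))"
      using ex[OF i] by metis
    have in_cube: "grid m (u m) \<in> hcube" if u: "\<And>m. near (q m) (u m)" for u m
    proof (rule grid_in)
      fix j assume "j < k"
      then show "u m j \<le> Suc m" using u[of m] q[of j m] by (force simp: near_def)
    qed
    have lim_g: "(\<lambda>m. g i (grid (\<phi> m) (u (\<phi> m)))) \<longlonglongrightarrow> g i s"
      if u: "\<And>m. near (q m) (u m)" for u
      using cont[OF i] s in_cube[OF u] lim_near[of "\<lambda>m. u (\<phi> m)"] u
      by (intro continuous_on_tendsto_compose[of hcube "g i"]) auto
    have "g i s \<le> \<tau> i"
      using LIMSEQ_le_const2[OF lim_g[OF r]] less by (meson less_imp_le)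
    moreover have "\<tau> i \<le> g i s"
      using LIMSEQ_le_const[OF lim_g[OF t]] ge by blast
    ultimately show ?thesis by simp
  qed
  with s show thesis using that by blast
qed

lemma underdetermined_homogeneous_system:
  fixes c :: "'v \<Rightarrow> 'j \<Rightarrow> real"
  assumes "finite W" "finite J" "card W < card J"
  shows "\<exists>\<alpha>. (\<exists>j\<in>J. \<alpha> j \<noteq> 0) \<and> (\<forall>V\<in>W. (\<Sum>j\<in>J. \<alpha> j * c V j) = 0)"
  using assms
proof (induction W arbitrary: J c rule: finite_induct)
  case empty
  then have "J \<noteq> {}" by auto
  then show ?case by (intro exI[of _ "\<lambda>_. 1"]) auto
next
  case (insert V W)
  show ?case
  proof (cases "\<forall>j\<in>J. c V j = 0")
    case True
    have "card W < card J" using insert by simp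
    then obtain \<alpha> where "\<exists>j\<in>J. \<alpha> j \<noteq> 0" "\<forall>V\<in>W. (\<Sum>j\<in>J. \<alpha> j * c V j) = 0"
      using insert.IH[OF insert.prems(1)] by blast
    then show ?thesis using True by (intro exI[of _ \<alpha>]) auto
  next
    case False
    then obtain j0 where j0: "j0 \<in> J" "c V j0 \<noteq> 0" by blast
    define c' where "c' U j = c U j - c U j0 * c V j / c V j0" for U j
    have "card W < card (J - {j0})"
      using insert j0 by simp
    then obtain \<alpha> where \<alpha>: "\<exists>j\<in>J-{j0}. \<alpha> j \<noteq> 0" "\<forall>U\<in>W. (\<Sum>j\<in>J-{j0}. \<alpha> j * c' U j) = 0"
      using insert.IH[of "J - {j0}" c'] insert.prems by blast
    define \<beta> where "\<beta> j = (if j = j0 then - (\<Sum>i\<in>J-{j0}. \<alpha> i * c V i) / c V j0 else \<alpha> j)" for j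
    have split: "(\<Sum>j\<in>J. \<beta> j * c U j) = (\<Sum>j\<in>J-{j0}. \<alpha> j * c' U j)" for U
    proof -
      have "(\<Sum>j\<in>J. \<beta> j * c U j) = \<beta> j0 * c U j0 + (\<Sum>j\<in>J-{j0}. \<beta> j * c U j)"
        using j0 insert.prems by (simp add: sum.remove)
      also have "(\<Sum>j\<in>J-{j0}. \<beta> j * c U j) = (\<Sum>j\<in>J-{j0}. \<alpha> j * c U j)"
        by (intro sum.cong) (auto simp: \<beta>_def)
      also have "\<beta> j0 * c U j0 = (\<Sum>j\<in>J-{j0}. - (c U j0 * (\<alpha> j * c V j) / c V j0))"
        by (simp add: \<beta>_def sum_negf sum_divide_distrib sum_distrib_left mult.commute)
      finally show ?thesis
        by (simp add: c'_def sum.distrib[symmetric] algebra_simps)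
    qed
    have "(\<Sum>j\<in>J-{j0}. \<alpha> j * c' V j) = 0"
      using j0 by (intro sum.neutral) (simp add: c'_def)
    then show ?thesis
      using \<alpha> split by (intro exI[of _ \<beta>]) (auto simp: \<beta>_def)
  qed
qed

text \<open>Lebesgue's covering theorem, for the sets where the functions of a partition of unity are
  positive: if none of them meets two opposite faces \<open>s i = 0\<close> and \<open>s i = 1\<close>, \<open>i < k\<close>, then some
  point lies in more than \<open>k\<close> of them.

  Send each member \<open>V\<close> of the cover to a vertex \<open>(c V 1, \<dots>, c V k)\<close> of the cube, with \<open>i\<close>-th
  coordinate 0 exactly if \<open>V\<close> touches the corresponding 0-face, and extend by the partition of
  unity. The resulting map preserves each face, so it is onto the open cube by the
  Poincare-Miranda theorem. If every point were in at most \<open>k\<close> members, the image would lie in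
  finitely many hyperplanes, each spanned by at most \<open>k\<close> vertices. The moment curve
  \<open>(x, x\<^sup>2, \<dots>, x\<^sup>k)\<close> meets each hyperplane in only finitely many points, so one of its points
  is missed.\<close>

lemma cube_covering_theorem:
  fixes f :: "'v \<Rightarrow> (nat \<Rightarrow> real) \<Rightarrow> real"
  assumes fin: "finite \<gamma>"
    and cont: "\<And>V. V \<in> \<gamma> \<Longrightarrow> continuous_on hcube (f V)"
    and nonneg: "\<And>V s. \<lbrakk>V \<in> \<gamma>; s \<in> hcube\<rbrakk> \<Longrightarrow> 0 \<le> f V s"
    and one: "\<And>s. s \<in> hcube \<Longrightarrow> (\<Sum>V\<in>\<gamma>. f V s) = 1"
    and faces: "\<And>V i s t. \<lbrakk>V \<in> \<gamma>; i < k; s \<in> hcube; t \<in> hcube; s i = 0; t i = 1;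
                  f V s > 0; f V t > 0\<rbrakk> \<Longrightarrow> False"
  shows "\<exists>s\<in>hcube. k < card {V \<in> \<gamma>. f V s > 0}"
proof (rule ccontr)
  assume "\<not> ?thesis"
  then have small: "card {V \<in> \<gamma>. f V s > 0} \<le> k" if "s \<in> hcube" for s
    using that by (meson not_le)
  \<comment> \<open>Index 0 carries the constant coordinate 1, so that a hyperplane in dimension \<open>k\<close> is the kernel
    of a linear form with \<open>k + 1\<close> coefficients; the cube coordinate \<open>i\<close> sits at index \<open>Suc i\<close>.\<close>
  define c :: "'v \<Rightarrow> nat \<Rightarrow> real" where
    "c V j = (if j = 0 then 1 else if \<exists>s\<in>hcube. s (j - 1) = 0 \<and> f V s > 0 then 0 else 1)" for V j
  \<comment> \<open>The polynomial whose roots are the parameters at which the moment curve meets the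
    hyperplane \<open>\<alpha>\<close>.\<close>
  define P where "P \<alpha> = (\<Sum>j\<le>k. monom (\<alpha> j) j)" for \<alpha> :: "nat \<Rightarrow> real"
  have "\<exists>\<alpha>. (\<exists>j\<le>k. \<alpha> j \<noteq> 0) \<and> (\<forall>V\<in>W. (\<Sum>j\<le>k. \<alpha> j * c V j) = 0)"
    if "W \<subseteq> \<gamma>" "card W \<le> k" for W
    using underdetermined_homogeneous_system[of W "{..k}" c] that fin finite_subset[of W \<gamma>]
    by (simp add: Bex_def)
  then obtain \<alpha> where \<alpha>_nz: "\<And>W. \<lbrakk>W \<subseteq> \<gamma>; card W \<le> k\<rbrakk> \<Longrightarrow> \<exists>j\<le>k. \<alpha> W j \<noteq> 0"
    and \<alpha>: "\<And>W V. \<lbrakk>W \<subseteq> \<gamma>; card W \<le> k; V \<in> W\<rbrakk> \<Longrightarrow> (\<Sum>j\<le>k. \<alpha> W j * c V j) = 0"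
    by metis
  have P_nz: "P (\<alpha> W) \<noteq> 0" if W: "W \<subseteq> \<gamma>" "card W \<le> k" for W
  proof -
    obtain j where "j \<le> k" "\<alpha> W j \<noteq> 0" using \<alpha>_nz[OF W] by blast
    moreover from this have "coeff (P (\<alpha> W)) j = \<alpha> W j"
      by (simp add: P_def coeff_sum)
    ultimately show ?thesis by auto
  qed
  \<comment> \<open>Through every set of at most \<open>k\<close> vertices one hyperplane has been chosen; these are the
    parameters at which the moment curve hits one of them.\<close>
  define bad where "bad = (\<Union>W\<in>{W. W \<subseteq> \<gamma> \<and> card W \<le> k}. {x. poly (P (\<alpha> W)) x = 0})"
  have "finite bad"
    unfolding bad_def
  proof (rule finite_UN_I)
    show "finite {W. W \<subseteq> \<gamma> \<and> card W \<le> k}"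
      by (rule finite_subset[of _ "Pow \<gamma>"]) (use fin in auto)
    show "finite {x. poly (P (\<alpha> W)) x = 0}" if "W \<in> {W. W \<subseteq> \<gamma> \<and> card W \<le> k}" for W
      using that P_nz[of W] by (intro poly_roots_finite) blast
  qed
  moreover have "infinite {0<..<1::real}" by (simp add: infinite_Ioo)
  ultimately have "\<not> {0<..<1} \<subseteq> bad" using finite_subset by blast
  then obtain x where x: "0 < x" "x < 1" "x \<notin> bad" by (auto simp: subset_iff)
  obtain s where s: "s \<in> hcube" and g: "\<And>i. i < k \<Longrightarrow> (\<Sum>V\<in>\<gamma>. f V s * c V (Suc i)) = x ^ Suc i"
  proof (rule poincare_miranda[where k=k and g="\<lambda>i s. \<Sum>V\<in>\<gamma>. f V s * c V (Suc i)" and \<tau>="\<lambda>i. x ^ Suc i"])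
    show "continuous_on hcube (\<lambda>s. \<Sum>V\<in>\<gamma>. f V s * c V (Suc i))" for i
      by (intro continuous_intros cont)
    fix i s assume i: "i < k" and s: "s \<in> hcube"
    show "(\<Sum>V\<in>\<gamma>. f V s * c V (Suc i)) < x ^ Suc i" if "s i = 0"
    proof -
      have "(\<Sum>V\<in>\<gamma>. f V s * c V (Suc i)) = 0"
      proof (intro sum.neutral ballI)
        fix V assume "V \<in> \<gamma>"
        then show "f V s * c V (Suc i) = 0"
          using nonneg[of V s] s that by (cases "f V s = 0") (auto simp: c_def)
      qed
      then show ?thesis using x by simp
    qed
    show "x ^ Suc i \<le> (\<Sum>V\<in>\<gamma>. f V s * c V (Suc i))" if "s i = 1"
    proof -
      have "(\<Sum>V\<in>\<gamma>. f V s * c V (Suc i)) = (\<Sum>V\<in>\<gamma>. f V s)"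
      proof (intro sum.cong refl)
        fix V assume V: "V \<in> \<gamma>"
        show "f V s * c V (Suc i) = f V s"
        proof (cases "f V s = 0")
          case False
          then have "f V s > 0" using nonneg[OF V s] by simp
          then show ?thesis using faces[OF V i _ s _ that] by (auto simp: c_def)
        qed auto
      qed
      then show ?thesis using one[OF s] x power_le_one[of x "Suc i"] by simp
    qed
  qed blast
  define W where "W = {V \<in> \<gamma>. f V s > 0}"
  have W: "W \<subseteq> \<gamma>" "card W \<le> k" using small[OF s] by (auto simp: W_def)
  have sumW: "(\<Sum>V\<in>\<gamma>. f V s * h V) = (\<Sum>V\<in>W. f V s * h V)" for h
  proof (intro sum.mono_neutral_right ballI fin W(1))
    fix V assume "V \<in> \<gamma> - W"
    then have "f V s = 0" using nonneg[of V s] s by (simp add: W_def)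
    then show "f V s * h V = 0" by simp
  qed
  have moments: "x ^ j = (\<Sum>V\<in>W. f V s * c V j)" if "j \<le> k" for j
  proof (cases j)
    case 0
    then show ?thesis using one[OF s] sumW[of "\<lambda>_. 1"] by (simp add: c_def)
  next
    case (Suc i)
    then show ?thesis using g[of i] sumW[of "\<lambda>V. c V (Suc i)"] that by simp
  qed
  have "poly (P (\<alpha> W)) x = (\<Sum>j\<le>k. \<alpha> W j * x ^ j)"
    by (simp add: P_def poly_sum poly_monom)
  also have "\<dots> = (\<Sum>j\<le>k. \<Sum>V\<in>W. f V s * (\<alpha> W j * c V j))"
    by (intro sum.cong refl) (simp add: moments sum_distrib_left mult.left_commute)
  also have "\<dots> = (\<Sum>V\<in>W. f V s * (\<Sum>j\<le>k. \<alpha> W j * c V j))"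
    by (subst sum.swap) (simp add: sum_distrib_left)
  also have "\<dots> = 0"
    using \<alpha>[OF W] by simp
  finally show False using W x by (auto simp: bad_def)
qed

section \<open>Partitions of unity on metrizable spaces\<close>

lemma finite_open_coverD:
  assumes "finite_open_cover X \<U>"
  shows "finite \<U>" "\<And>U. U \<in> \<U> \<Longrightarrow> openin X U" "\<Union>\<U> = topspace X"
    "\<And>U. U \<in> \<U> \<Longrightarrow> U \<subseteq> topspace X"
  using assms by (auto simp: finite_open_cover_def)

text \<open>The distance to the complement is a witness; only the whole space, whose complement is empty,
  needs another one.\<close>

lemma (in Metric_space) openin_eq_positivity_set:
  assumes V: "openin mtopology V"
  obtains f :: "'a \<Rightarrow> real" where "continuous_map mtopology euclideanreal f"
    "\<And>x. x \<in> M \<Longrightarrow> 0 \<le> f x" "\<And>x. x \<in> M \<Longrightarrow> 0 < f x \<longleftrightarrow> x \<in> V"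
proof (cases "V = M")
  case True
  then show ?thesis by (intro that[of "\<lambda>_. 1"]) auto
next
  case False
  have VM: "V \<subseteq> M" using openin_subset[OF V] by simp
  with False obtain z where z: "z \<in> M - V" by blast
  define f where "f x = (INF y\<in>M - V. d x y)" for x
  have bdd: "bdd_below ((\<lambda>y. d x y) ` (M - V))" for x
    by (rule bdd_belowI[of _ 0]) auto
  have nonneg: "0 \<le> f x" for x
    unfolding f_def using z by (intro cINF_greatest) auto
  have lip: "f x \<le> d x x' + f x'" if "x \<in> M" "x' \<in> M" for x x'
  proof -
    have "f x - d x x' \<le> d x' y" if y: "y \<in> M - V" for y
    proof -
      have "f x \<le> d x y" unfolding f_def using bdd y by (rule cINF_lower)
      also have "\<dots> \<le> d x x' + d x' y" using triangle \<open>x \<in> M\<close> \<open>x' \<in> M\<close> y by blast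
      finally show ?thesis by simp
    qed
    then have "f x - d x x' \<le> f x'"
      unfolding f_def[of x'] using z by (intro cINF_greatest) auto
    then show ?thesis by simp
  qed
  have "continuous_map mtopology Met_TC.mtopology f"
    unfolding Metric_space.metric_continuous_map[OF Metric_space_axioms Met_TC.Metric_space_axioms]
  proof (intro conjI ballI allI impI)
    fix x \<epsilon> :: real and a assume a: "a \<in> M" "0 < \<epsilon>"
    have "dist (f a) (f x) < \<epsilon>" if "x \<in> M \<and> d a x < \<epsilon>" for x
      using that a lip[of a x] lip[of x a] commute[of a x] by (auto simp: dist_real_def abs_less_iff)
    with \<open>0 < \<epsilon>\<close> show "\<exists>\<delta>>0. \<forall>x. x \<in> M \<and> d a x < \<delta> \<longrightarrow> dist (f a) (f x) < \<epsilon>" by blast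
  qed auto
  moreover have "0 < f x \<longleftrightarrow> x \<in> V" if x: "x \<in> M" for x
  proof
    assume "0 < f x"
    show "x \<in> V"
    proof (rule ccontr)
      assume "x \<notin> V"
      then have "f x \<le> d x x" unfolding f_def using bdd x by (intro cINF_lower) auto
      with \<open>0 < f x\<close> x show False by simp
    qed
  next
    assume "x \<in> V"
    then obtain r where r: "r > 0" "mball x r \<subseteq> V"
      using V openin_mtopology by blast
    have "r \<le> f x"
      unfolding f_def
    proof (rule cINF_greatest)
      show "r \<le> d x y" if "y \<in> M - V" for y
        using that r(2) x by (auto simp: subset_iff not_less[symmetric])
    qed (use z in blast)
    with r show "0 < f x" by simp
  qed
  ultimately show ?thesis
    using nonneg by (intro that[of f]) auto
qed

lemma partition_of_unity:
  assumes X: "metrizable_space X" and cover: "finite_open_cover X \<gamma>"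
  obtains f :: "'a set \<Rightarrow> 'a \<Rightarrow> real" where
    "\<And>V. V \<in> \<gamma> \<Longrightarrow> continuous_map X euclideanreal (f V)"
    "\<And>V x. \<lbrakk>V \<in> \<gamma>; x \<in> topspace X\<rbrakk> \<Longrightarrow> 0 \<le> f V x"
    "\<And>V x. \<lbrakk>V \<in> \<gamma>; x \<in> topspace X\<rbrakk> \<Longrightarrow> 0 < f V x \<longleftrightarrow> x \<in> V"
    "\<And>x. x \<in> topspace X \<Longrightarrow> (\<Sum>V\<in>\<gamma>. f V x) = 1"
proof -
  note \<gamma> = finite_open_coverD[OF cover]
  define P where "P V f \<longleftrightarrow> continuous_map X euclideanreal f \<and>
      (\<forall>x\<in>topspace X. 0 \<le> f x \<and> (0 < f x \<longleftrightarrow> x \<in> V))" for V and f :: "'a \<Rightarrow> real"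
  obtain M d where M: "Metric_space M d" and Xeq: "X = Metric_space.mtopology M d"
    using X metrizable_space_def by blast
  interpret Metric_space M d by (rule M)
  have "\<exists>f. P V f" if "V \<in> \<gamma>" for V
  proof -
    have "openin mtopology V" using \<gamma>(2)[OF that] by (simp add: Xeq)
    then obtain f :: "'a \<Rightarrow> real" where "continuous_map mtopology euclideanreal f"
      "\<And>x. x \<in> M \<Longrightarrow> 0 \<le> f x" "\<And>x. x \<in> M \<Longrightarrow> 0 < f x \<longleftrightarrow> x \<in> V"
      using openin_eq_positivity_set by blast
    then have "P V f" by (simp add: P_def Xeq)
    then show ?thesis by blast
  qed
  then obtain g where gP: "\<And>V. V \<in> \<gamma> \<Longrightarrow> P V (g V)" by metis
  have g: "\<And>V. V \<in> \<gamma> \<Longrightarrow> continuous_map X euclideanreal (g V)"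
    "\<And>V x. \<lbrakk>V \<in> \<gamma>; x \<in> topspace X\<rbrakk> \<Longrightarrow> 0 \<le> g V x"
    "\<And>V x. \<lbrakk>V \<in> \<gamma>; x \<in> topspace X\<rbrakk> \<Longrightarrow> 0 < g V x \<longleftrightarrow> x \<in> V"
    using gP by (simp_all add: P_def)
  define S where "S x = (\<Sum>V\<in>\<gamma>. g V x)" for x
  have S: "S x > 0" if x: "x \<in> topspace X" for x
  proof -
    obtain V where "V \<in> \<gamma>" "x \<in> V" using \<gamma>(3) x by blast
    then show ?thesis
      unfolding S_def using \<gamma>(1) g x by (intro sum_pos2[of \<gamma> V]) auto
  qed
  show thesis
  proof (rule that[of "\<lambda>V x. g V x / S x"])
    show "continuous_map X euclideanreal (\<lambda>x. g V x / S x)" if "V \<in> \<gamma>" for V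
    proof (intro continuous_map_real_divide g(1) that)
      show "continuous_map X euclideanreal S"
        unfolding S_def by (intro continuous_map_sum \<gamma>(1) g(1))
      show "S x \<noteq> 0" if "x \<in> topspace X" for x
        using S[OF that] by simp
    qed
    show "0 \<le> g V x / S x" if "V \<in> \<gamma>" "x \<in> topspace X" for V x
      using g(2)[OF that] S[OF that(2)] by simp
    show "0 < g V x / S x \<longleftrightarrow> x \<in> V" if "V \<in> \<gamma>" "x \<in> topspace X" for V x
      using g(3)[OF that] S[OF that(2)] by (simp add: zero_less_divide_iff)
    show "(\<Sum>V\<in>\<gamma>. g V x / S x) = 1" if "x \<in> topspace X" for x
      using S[OF that] by (simp add: S_def flip: sum_divide_distrib)
  qed
qed

section \<open>Subadditivity of cover dimension\<close>

lemma card_members_le_cover_ord: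
  assumes "finite \<gamma>" "x \<in> topspace X"
  shows "card {V \<in> \<gamma>. x \<in> V} \<le> cover_ord X \<gamma> + 1"
proof -
  let ?m = "(\<lambda>x. card {U \<in> \<gamma>. x \<in> U})"
  have "?m ` topspace X \<subseteq> {..card \<gamma>}"
    using assms(1) by (auto intro: card_mono)
  then have "finite (?m ` topspace X)" by (rule finite_subset) simp
  then have "?m x \<le> Max (?m ` topspace X)" using assms(2) by (intro Max_ge) auto
  then show ?thesis by (simp add: cover_ord_def)
qed

lemma cover_ord_leI:
  assumes "topspace X \<noteq> {}" "\<And>x. x \<in> topspace X \<Longrightarrow> card {V \<in> \<gamma>. x \<in> V} \<le> k + 1"
  shows "cover_ord X \<gamma> \<le> k"
proof -
  let ?m = "(\<lambda>x. card {U \<in> \<gamma>. x \<in> U})"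
  have sub: "?m ` topspace X \<subseteq> {..k + 1}" using assms(2) by auto
  then have "finite (?m ` topspace X)" by (rule finite_subset) simp
  then have "Max (?m ` topspace X) \<le> k + 1" using assms sub by (subst Max_le_iff) auto
  then show ?thesis by (simp add: cover_ord_def)
qed

lemma refines_self: "refines \<U> \<U>"
  by (auto simp: refines_def)

lemma cover_D_le:
  assumes "finite_open_cover X \<gamma>" "refines \<gamma> \<U>"
  shows "cover_D X \<U> \<le> cover_ord X \<gamma>"
  unfolding cover_D_def using assms by (intro cInf_lower) auto

lemma cover_D_attained:
  assumes "finite_open_cover X \<U>"
  obtains \<gamma> where "finite_open_cover X \<gamma>" "refines \<gamma> \<U>" "cover_ord X \<gamma> = cover_D X \<U>"
proof -
  let ?S = "{cover_ord X \<gamma> | \<gamma>. finite_open_cover X \<gamma> \<and> refines \<gamma> \<U>}"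
  have "?S \<noteq> {}" using assms refines_self by blast
  then have "Inf ?S \<in> ?S" by (rule Inf_nat_def1)
  then show ?thesis using that unfolding cover_D_def by force
qed

lemma mem_cover_join_iff: "A \<in> cover_join \<U> \<V> \<longleftrightarrow> (\<exists>U\<in>\<U>. \<exists>V\<in>\<V>. A = U \<inter> V)"
  by (auto simp: cover_join_def)

lemma bex_cover_join_iff: "(\<exists>A\<in>cover_join \<U> \<V>. P A) \<longleftrightarrow> (\<exists>U\<in>\<U>. \<exists>V\<in>\<V>. P (U \<inter> V))"
  by (auto simp: cover_join_def)

lemma finite_open_cover_join:
  assumes \<U>: "finite_open_cover X \<U>" and \<V>: "finite_open_cover X \<V>"
  shows "finite_open_cover X (cover_join \<U> \<V>)"
proof -
  note \<U>' = finite_open_coverD[OF \<U>] and \<V>' = finite_open_coverD[OF \<V>]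
  have "cover_join \<U> \<V> = (\<lambda>(U, V). U \<inter> V) ` (\<U> \<times> \<V>)"
    by (auto simp: cover_join_def)
  then have "finite (cover_join \<U> \<V>)" using \<U>'(1) \<V>'(1) by simp
  moreover have "\<forall>A\<in>cover_join \<U> \<V>. openin X A"
    using \<U>'(2) \<V>'(2) by (auto simp: cover_join_def)
  moreover have "x \<in> \<Union>(cover_join \<U> \<V>) \<longleftrightarrow> x \<in> \<Union>\<U> \<and> x \<in> \<Union>\<V>" for x
    unfolding Union_iff bex_cover_join_iff by blast
  ultimately show ?thesis
    unfolding finite_open_cover_def using \<U>'(3) \<V>'(3) by blast
qed

lemma continuous_map_funpow: "continuous_map X X T \<Longrightarrow> continuous_map X X (T ^^ i)"
  by (induction i) (auto intro: continuous_map_compose simp: id_def[symmetric])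

lemma finite_open_cover_pullback:
  assumes \<U>: "finite_open_cover X \<U>" and T: "continuous_map X X T"
  shows "finite_open_cover X (cover_pullback X T i \<U>)"
proof -
  note Ti = continuous_map_funpow[OF T, of i]
  note \<U>' = finite_open_coverD[OF \<U>]
  have "\<Union>(cover_pullback X T i \<U>) = topspace X"
    using \<U>'(3) continuous_map_funspace[OF Ti] by (fastforce simp: cover_pullback_def)
  moreover have "openin X {x \<in> topspace X. (T ^^ i) x \<in> U}" if "U \<in> \<U>" for U
    using Ti \<U>'(2)[OF that] by (rule openin_continuous_map_preimage)
  ultimately show ?thesis
    using \<U>'(1) by (auto simp: finite_open_cover_def cover_pullback_def)
qed

lemma finite_open_cover_iter:
  assumes "finite_open_cover X \<U>" "continuous_map X X T"
  shows "finite_open_cover X (cover_iter X T \<U> n)"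
proof (induction n)
  case 0
  then show ?case by (simp add: finite_open_cover_def)
next
  case (Suc n)
  then show ?case
    using assms by (simp add: finite_open_cover_join finite_open_cover_pullback)
qed

text \<open>The sum of the two ranks increases strictly along a chain of the product order, and it takes
  at most \<open>card I + card J - 1\<close> values on \<open>I \<times> J\<close>.\<close>

lemma card_chain_product:
  fixes S :: "(nat \<times> nat) set"
  assumes fin: "finite I" "finite J" and S: "S \<subseteq> I \<times> J" "S \<noteq> {}"
    and chain: "\<And>i j i' j'. \<lbrakk>(i, j) \<in> S; (i', j') \<in> S; i < i'\<rbrakk> \<Longrightarrow> j \<le> j'"
  shows "card S + 1 \<le> card I + card J"
proof -
  define r where "r K i = card {i' \<in> K. i' < i}" for K :: "nat set" and i
  have r_less: "r K i < card K" if "finite K" "i \<in> K" for K i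
    unfolding r_def using that by (intro psubset_card_mono) auto
  have r_mono: "r K i \<le> r K i'" if "finite K" "i \<le> i'" for K i i'
    unfolding r_def using that by (intro card_mono) auto
  have r_smono: "r K i < r K i'" if "finite K" "i \<in> K" "i < i'" for K i i'
    unfolding r_def using that by (intro psubset_card_mono) auto
  define \<rho> where "\<rho> = (\<lambda>(i, j). r I i + r J j)"
  have neq: "\<rho> (i, j) \<noteq> \<rho> (i', j')" if p: "(i, j) \<in> S" "(i', j') \<in> S" "i < i' \<or> i = i' \<and> j < j'" for i j i' j'
  proof -
    have ij: "i \<in> I" "j \<in> J" using p S by auto
    from p(3) have "r I i + r J j < r I i' + r J j'"
    proof
      assume "i < i'"
      then show ?thesis
        using r_smono[OF fin(1) ij(1), of i'] r_mono[OF fin(2), of j j'] chain[OF p(1,2)] by simp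
    next
      assume "i = i' \<and> j < j'"
      then show ?thesis using r_smono[OF fin(2) ij(2), of j'] by simp
    qed
    then show ?thesis by (simp add: \<rho>_def)
  qed
  have "inj_on \<rho> S"
  proof (rule inj_onI)
    fix p p' assume "p \<in> S" "p' \<in> S" "\<rho> p = \<rho> p'"
    then have "\<not> (fst p < fst p' \<or> fst p = fst p' \<and> snd p < snd p')"
      "\<not> (fst p' < fst p \<or> fst p' = fst p \<and> snd p' < snd p)"
      using neq[of "fst p" "snd p" "fst p'" "snd p'"] neq[of "fst p'" "snd p'" "fst p" "snd p"] by auto
    then show "p = p'" by (metis linorder_neqE_nat prod_eq_iff)
  qed
  moreover have "\<rho> ` S \<subseteq> {..<card I + card J - 1}"
  proof (rule image_subsetI)
    fix p assume "p \<in> S"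
    then have "r I (fst p) < card I" "r J (snd p) < card J"
      using r_less[OF fin(1), of "fst p"] r_less[OF fin(2), of "snd p"] S by auto
    then show "\<rho> p \<in> {..<card I + card J - 1}" by (auto simp: \<rho>_def split: prod.split)
  qed
  ultimately have "card S \<le> card {..<card I + card J - 1}"
    by (intro card_inj_on_le) auto
  moreover have "card I > 0"
    using fin S by (auto simp: card_gt_0_iff)
  ultimately show ?thesis by simp
qed

text \<open>Dimension of covers is subadditive although a join of two covers of orders \<open>k\<close> and \<open>l\<close> has, in
  general, order \<open>k l + k + l\<close>. Subordinate partitions of unity turn every point \<open>x\<close> into two
  subdivisions of \<open>[0,1]\<close>, into intervals of lengths \<open>f (u i) x\<close> and \<open>g (v j) x\<close>. The set \<open>w (i, j)\<close>
  consists of the \<open>x\<close> for which the \<open>i\<close>-th interval of the first subdivision and the \<open>j\<close>-th of the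
  second overlap. These sets refine the join, and the pairs of overlapping intervals at a given
  \<open>x\<close> form a chain, because both subdivisions are ordered along the line. This is the staircase
  triangulation of a product of two simplices.\<close>

lemma cover_D_join_le:
  assumes X: "metrizable_space X" "topspace X \<noteq> {}"
    and \<U>: "finite_open_cover X \<U>" and \<V>: "finite_open_cover X \<V>"
  shows "cover_D X (cover_join \<U> \<V>) \<le> cover_D X \<U> + cover_D X \<V>"
proof -
  obtain \<gamma> where \<gamma>: "finite_open_cover X \<gamma>" "refines \<gamma> \<U>" "cover_ord X \<gamma> = cover_D X \<U>"
    using cover_D_attained[OF \<U>] .
  obtain \<delta> where \<delta>: "finite_open_cover X \<delta>" "refines \<delta> \<V>" "cover_ord X \<delta> = cover_D X \<V>"
    using cover_D_attained[OF \<V>] .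
  note \<gamma>' = finite_open_coverD[OF \<gamma>(1)] and \<delta>' = finite_open_coverD[OF \<delta>(1)]
  obtain f where f: "\<And>V. V \<in> \<gamma> \<Longrightarrow> continuous_map X euclideanreal (f V)"
    "\<And>V x. \<lbrakk>V \<in> \<gamma>; x \<in> topspace X\<rbrakk> \<Longrightarrow> 0 \<le> f V x"
    "\<And>V x. \<lbrakk>V \<in> \<gamma>; x \<in> topspace X\<rbrakk> \<Longrightarrow> 0 < f V x \<longleftrightarrow> x \<in> V"
    "\<And>x. x \<in> topspace X \<Longrightarrow> (\<Sum>V\<in>\<gamma>. f V x) = 1"
    using partition_of_unity[OF X(1) \<gamma>(1)] by blast
  obtain g where g: "\<And>V. V \<in> \<delta> \<Longrightarrow> continuous_map X euclideanreal (g V)"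
    "\<And>V x. \<lbrakk>V \<in> \<delta>; x \<in> topspace X\<rbrakk> \<Longrightarrow> 0 \<le> g V x"
    "\<And>V x. \<lbrakk>V \<in> \<delta>; x \<in> topspace X\<rbrakk> \<Longrightarrow> 0 < g V x \<longleftrightarrow> x \<in> V"
    "\<And>x. x \<in> topspace X \<Longrightarrow> (\<Sum>V\<in>\<delta>. g V x) = 1"
    using partition_of_unity[OF X(1) \<delta>(1)] by blast
  obtain u where u: "bij_betw u {..<card \<gamma>} \<gamma>"
    using ex_bij_betw_nat_finite[OF \<gamma>'(1)] by (metis atLeast0LessThan)
  obtain v where v: "bij_betw v {..<card \<delta>} \<delta>"
    using ex_bij_betw_nat_finite[OF \<delta>'(1)] by (metis atLeast0LessThan)
  have uin: "u i \<in> \<gamma>" if "i < card \<gamma>" for i using bij_betwE[OF u] that by blast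
  have vin: "v j \<in> \<delta>" if "j < card \<delta>" for j using bij_betwE[OF v] that by blast
  define F where "F i x = (\<Sum>l<i. f (u l) x)" for i x
  define G where "G j x = (\<Sum>l<j. g (v l) x)" for j x
  have F_mono: "F i x \<le> F i' x" if "i \<le> i'" "i' \<le> card \<gamma>" "x \<in> topspace X" for i i' x
    unfolding F_def using that f(2) uin by (intro sum_mono2) auto
  have G_mono: "G j x \<le> G j' x" if "j \<le> j'" "j' \<le> card \<delta>" "x \<in> topspace X" for j j' x
    unfolding G_def using that g(2) vin by (intro sum_mono2) auto
  have F_top: "F (card \<gamma>) x = 1" if "x \<in> topspace X" for x
    unfolding F_def using f(4)[OF that] sum.reindex_bij_betw[OF u, of "\<lambda>V. f V x"] by simp
  have G_top: "G (card \<delta>) x = 1" if "x \<in> topspace X" for x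
    unfolding G_def using g(4)[OF that] sum.reindex_bij_betw[OF v, of "\<lambda>V. g V x"] by simp
  have F_cont: "continuous_map X euclideanreal (F i)" if "i \<le> card \<gamma>" for i
    unfolding F_def using that uin f(1) by (intro continuous_map_sum) auto
  have G_cont: "continuous_map X euclideanreal (G j)" if "j \<le> card \<delta>" for j
    unfolding G_def using that vin g(1) by (intro continuous_map_sum) auto
  define P where "P = {..<card \<gamma>} \<times> {..<card \<delta>}"
  define w where
    "w = (\<lambda>(i, j). {x \<in> topspace X. max (F i x) (G j x) < min (F (Suc i) x) (G (Suc j) x)})"
  have w_open: "openin X (w p)" if pP: "p \<in> P" for p
  proof -
    obtain i j where p: "p = (i, j)" "i < card \<gamma>" "j < card \<delta>" using pP by (auto simp: P_def)
    have "continuous_map X euclideanreal (\<lambda>x. min (F (Suc i) x) (G (Suc j) x) - max (F i x) (G j x))"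
      using p by (intro continuous_intros F_cont G_cont) auto
    from openin_continuous_map_preimage[OF this, of "{0<..}"]
    show ?thesis by (simp add: p w_def)
  qed
  have w_cover: "\<exists>p\<in>P. x \<in> w p" if x: "x \<in> topspace X" for x
  proof -
    \<comment> \<open>The first nondegenerate intervals of the two subdivisions both start at 0, so they overlap.\<close>
    define m where "m = (LEAST i. 0 < F i x)"
    define n where "n = (LEAST j. 0 < G j x)"
    have Fpos: "0 < F (card \<gamma>) x" and Gpos: "0 < G (card \<delta>) x"
      using F_top[OF x] G_top[OF x] by simp_all
    have m: "0 < F m x" "m \<le> card \<gamma>" unfolding m_def
      using LeastI[of "\<lambda>i. 0 < F i x", OF Fpos] Least_le[of "\<lambda>i. 0 < F i x", OF Fpos] .
    have n: "0 < G n x" "n \<le> card \<delta>" unfolding n_def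
      using LeastI[of "\<lambda>j. 0 < G j x", OF Gpos] Least_le[of "\<lambda>j. 0 < G j x", OF Gpos] .
    obtain i where i: "m = Suc i" using m(1) by (cases m) (auto simp: F_def)
    obtain j where j: "n = Suc j" using n(1) by (cases n) (auto simp: G_def)
    have "\<not> 0 < F i x" using not_less_Least[of i "\<lambda>i. 0 < F i x"] i by (simp add: m_def)
    moreover have "\<not> 0 < G j x" using not_less_Least[of j "\<lambda>j. 0 < G j x"] j by (simp add: n_def)
    ultimately have "x \<in> w (i, j)" using m(1) n(1) x i j by (auto simp: w_def)
    moreover have "(i, j) \<in> P" using m(2) n(2) i j by (auto simp: P_def)
    ultimately show ?thesis by blast
  qed
  have w_sub: "x \<in> u i" "x \<in> v j" if "(i, j) \<in> P" "x \<in> w (i, j)" for i j x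
  proof -
    have x: "x \<in> topspace X" and ij: "i < card \<gamma>" "j < card \<delta>"
      and "F i x < F (Suc i) x" "G j x < G (Suc j) x"
      using that by (auto simp: w_def P_def)
    then have "0 < f (u i) x" "0 < g (v j) x" by (simp_all add: F_def G_def)
    then show "x \<in> u i" "x \<in> v j"
      using f(3)[OF uin[OF ij(1)] x] g(3)[OF vin[OF ij(2)] x] by simp_all
  qed
  have cover: "finite_open_cover X (w ` P)"
    unfolding finite_open_cover_def
  proof (intro conjI)
    show "finite (w ` P)" by (simp add: P_def)
    show "\<forall>W\<in>w ` P. openin X W" using w_open by blast
    show "\<Union>(w ` P) = topspace X"
    proof
      show "\<Union>(w ` P) \<subseteq> topspace X" using w_open[THEN openin_subset] by (rule UN_least)
      show "topspace X \<subseteq> \<Union>(w ` P)" using w_cover by blast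
    qed
  qed
  have "refines (w ` P) (cover_join \<U> \<V>)"
    unfolding refines_def
  proof (intro ballI, elim imageE)
    fix W p assume "W = w p" "p \<in> P"
    obtain i j where p: "p = (i, j)" by force
    have "u i \<in> \<gamma>" "v j \<in> \<delta>" using \<open>p \<in> P\<close> uin vin by (auto simp: p P_def)
    obtain U where U: "U \<in> \<U>" "u i \<subseteq> U"
      using \<gamma>(2) \<open>u i \<in> \<gamma>\<close> unfolding refines_def by blast
    obtain V where V: "V \<in> \<V>" "v j \<subseteq> V"
      using \<delta>(2) \<open>v j \<in> \<delta>\<close> unfolding refines_def by blast
    have "W \<subseteq> U \<inter> V"
      using w_sub[of i j] \<open>W = w p\<close> \<open>p \<in> P\<close> U(2) V(2) unfolding p by blast
    then show "\<exists>U\<in>cover_join \<U> \<V>. W \<subseteq> U"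
      unfolding bex_cover_join_iff using U(1) V(1) by blast
  qed
  moreover have "cover_ord X (w ` P) \<le> cover_D X \<U> + cover_D X \<V>"
  proof (rule cover_ord_leI[OF X(2)])
    fix x assume x: "x \<in> topspace X"
    define S where "S = {p \<in> P. x \<in> w p}"
    have "{W \<in> w ` P. x \<in> W} = w ` S" by (auto simp: S_def)
    then have "card {W \<in> w ` P. x \<in> W} \<le> card S"
      by (simp add: S_def P_def card_image_le)
    also have "card S + 1 \<le> card {i. i < card \<gamma> \<and> x \<in> u i} + card {j. j < card \<delta> \<and> x \<in> v j}"
    proof (rule card_chain_product)
      show "S \<subseteq> {i. i < card \<gamma> \<and> x \<in> u i} \<times> {j. j < card \<delta> \<and> x \<in> v j}"
        using w_sub by (auto simp: S_def P_def)
      show "S \<noteq> {}" using w_cover[OF x] by (auto simp: S_def)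
      fix i j i' j' assume S: "(i, j) \<in> S" "(i', j') \<in> S" and less: "i < i'"
      then have a: "G j x < F (Suc i) x" "F i' x < G (Suc j') x" and b: "i' < card \<gamma>" "j < card \<delta>"
        by (auto simp: S_def w_def P_def)
      have "F (Suc i) x \<le> F i' x" using less b x by (intro F_mono) auto
      with a have "G j x < G (Suc j') x" by simp
      moreover have "G (Suc j') x \<le> G j x" if "Suc j' \<le> j"
        using that b x by (intro G_mono) auto
      ultimately show "j \<le> j'" by linarith
    qed auto
    also have "card {i. i < card \<gamma> \<and> x \<in> u i} \<le> card {V \<in> \<gamma>. x \<in> V}"
    proof (rule card_inj_on_le)
      show "inj_on u {i. i < card \<gamma> \<and> x \<in> u i}"
        by (rule inj_on_subset[OF bij_betw_imp_inj_on[OF u]]) auto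
    qed (use \<gamma>'(1) uin in auto)
    also have "card {j. j < card \<delta> \<and> x \<in> v j} \<le> card {V \<in> \<delta>. x \<in> V}"
    proof (rule card_inj_on_le)
      show "inj_on v {j. j < card \<delta> \<and> x \<in> v j}"
        by (rule inj_on_subset[OF bij_betw_imp_inj_on[OF v]]) auto
    qed (use \<delta>'(1) vin in auto)
    finally have "card {W \<in> w ` P. x \<in> W} + 1 \<le> card {V \<in> \<gamma>. x \<in> V} + card {V \<in> \<delta>. x \<in> V}"
      by simp
    then show "card {W \<in> w ` P. x \<in> W} \<le> cover_D X \<U> + cover_D X \<V> + 1"
      using card_members_le_cover_ord[OF \<gamma>'(1) x] card_members_le_cover_ord[OF \<delta>'(1) x] \<gamma>(3) \<delta>(3)
      by simp
  qed
  ultimately show ?thesis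
    using cover_D_le[OF cover] by (meson le_trans)
qed

lemma cover_D_pullback_le:
  assumes ne: "topspace X \<noteq> {}" and \<U>: "finite_open_cover X \<U>" and T: "continuous_map X X T"
  shows "cover_D X (cover_pullback X T i \<U>) \<le> cover_D X \<U>"
proof -
  obtain \<gamma> where \<gamma>: "finite_open_cover X \<gamma>" "refines \<gamma> \<U>" "cover_ord X \<gamma> = cover_D X \<U>"
    using cover_D_attained[OF \<U>] .
  note fin = finite_open_coverD(1)[OF \<gamma>(1)]
  have "refines (cover_pullback X T i \<gamma>) (cover_pullback X T i \<U>)"
    unfolding refines_def cover_pullback_def ball_simps(9) bex_simps(7)
  proof
    fix V assume "V \<in> \<gamma>"
    then obtain U where "U \<in> \<U>" "V \<subseteq> U" using \<gamma>(2) unfolding refines_def by blast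
    then show "\<exists>U\<in>\<U>. {x \<in> topspace X. (T ^^ i) x \<in> V} \<subseteq> {x \<in> topspace X. (T ^^ i) x \<in> U}"
      by (intro bexI[of _ U]) auto
  qed
  then have "cover_D X (cover_pullback X T i \<U>) \<le> cover_ord X (cover_pullback X T i \<gamma>)"
    using finite_open_cover_pullback[OF \<gamma>(1) T] by (intro cover_D_le)
  also have "\<dots> \<le> cover_D X \<U>"
  proof (rule cover_ord_leI[OF ne])
    fix x assume x: "x \<in> topspace X"
    have Tx: "(T ^^ i) x \<in> topspace X"
      using continuous_map_funspace[OF continuous_map_funpow[OF T]] x by blast
    have "{W \<in> cover_pullback X T i \<gamma>. x \<in> W}
        \<subseteq> (\<lambda>U. {x \<in> topspace X. (T ^^ i) x \<in> U}) ` {V \<in> \<gamma>. (T ^^ i) x \<in> V}"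
      by (auto simp: cover_pullback_def)
    then have "card {W \<in> cover_pullback X T i \<gamma>. x \<in> W} \<le> card {V \<in> \<gamma>. (T ^^ i) x \<in> V}"
      using fin by (intro surj_card_le) auto
    also have "\<dots> \<le> cover_D X \<U> + 1"
      using card_members_le_cover_ord[OF fin Tx] \<gamma>(3) by simp
    finally show "card {W \<in> cover_pullback X T i \<gamma>. x \<in> W} \<le> cover_D X \<U> + 1" .
  qed
  finally show ?thesis .
qed

lemma cover_join_assoc: "cover_join (cover_join \<U> \<V>) \<W> = cover_join \<U> (cover_join \<V> \<W>)"
  by (rule set_eqI) (simp add: mem_cover_join_iff bex_cover_join_iff Int_assoc)

lemma cover_pullback_join:
  "cover_pullback X T i (cover_join \<U> \<V>) = cover_join (cover_pullback X T i \<U>) (cover_pullback X T i \<V>)"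
proof (rule set_eqI)
  fix A
  have "{x \<in> topspace X. (T ^^ i) x \<in> U \<inter> V}
      = {x \<in> topspace X. (T ^^ i) x \<in> U} \<inter> {x \<in> topspace X. (T ^^ i) x \<in> V}" for U V
    by blast
  then show "A \<in> cover_pullback X T i (cover_join \<U> \<V>)
      \<longleftrightarrow> A \<in> cover_join (cover_pullback X T i \<U>) (cover_pullback X T i \<V>)"
    unfolding mem_cover_join_iff cover_pullback_def image_iff bex_cover_join_iff bex_simps(7)
    by simp
qed

lemma cover_pullback_pullback:
  assumes "continuous_map X X T"
  shows "cover_pullback X T m (cover_pullback X T n \<U>) = cover_pullback X T (m + n) \<U>"
proof -
  have "(T ^^ m) x \<in> topspace X" if "x \<in> topspace X" for x
    using continuous_map_funspace[OF continuous_map_funpow[OF assms]] that by blast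
  then have "{x \<in> topspace X. (T ^^ m) x \<in> {y \<in> topspace X. (T ^^ n) y \<in> U}}
      = {x \<in> topspace X. (T ^^ (m + n)) x \<in> U}" for U
    by (auto simp: add.commute[of m n] funpow_add)
  then show ?thesis by (simp add: cover_pullback_def image_image)
qed

lemma cover_iter_add:
  assumes \<U>: "finite_open_cover X \<U>" and T: "continuous_map X X T"
  shows "cover_iter X T \<U> (m + n) = cover_join (cover_iter X T \<U> m) (cover_pullback X T m (cover_iter X T \<U> n))"
proof (induction n)
  case 0
  have "{x \<in> topspace X. (T ^^ m) x \<in> topspace X} = topspace X"
    using continuous_map_funspace[OF continuous_map_funpow[OF T]] by blast
  moreover have "U \<inter> topspace X = U" if "U \<in> cover_iter X T \<U> m" for U
    using finite_open_coverD(4)[OF finite_open_cover_iter[OF \<U> T] that] by blast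
  then have "{U \<inter> topspace X | U. U \<in> cover_iter X T \<U> m} = cover_iter X T \<U> m"
    by auto
  ultimately show ?case by (simp add: cover_pullback_def cover_join_def)
next
  case (Suc n)
  then show ?case
    by (simp add: cover_join_assoc cover_pullback_join cover_pullback_pullback[OF T])
qed

text \<open>Fekete's lemma: the limit is the infimum over the positive indices.\<close>

lemma convergent_subadditive:
  fixes a :: "nat \<Rightarrow> nat"
  assumes sub: "\<And>m n. a (m + n) \<le> a m + a n"
  shows "convergent (\<lambda>n. real (a n) / real n)"
proof -
  define L where "L = (INF n\<in>{1..}. real (a n) / real n)"
  have bdd: "bdd_below ((\<lambda>n. real (a n) / real n) ` {1..})"
    by (rule bdd_belowI[of _ 0]) auto
  have mult: "a (q * m) \<le> q * a m" if "q > 0" for q m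
    using that
  proof (induction q rule: nat_induct_non_zero)
    case (Suc q)
    then show ?case using sub[of m "q * m"] by simp
  qed simp
  have "(\<lambda>n. real (a n) / real n) \<longlonglongrightarrow> L"
  proof (rule LIMSEQ_I)
    fix e :: real assume e: "e > 0"
    obtain m where m: "m \<ge> 1" "real (a m) / real m < L + e / 2"
      using cInf_lessD[of "(\<lambda>n. real (a n) / real n) ` {1..}" "L + e / 2"] e unfolding L_def by force
    define C where "C = Max (a ` {..<m})"
    have C: "a r \<le> C" if "r < m" for r unfolding C_def using that by (intro Max_ge) auto
    obtain N :: nat where N: "real N > real C / (e / 2)" using reals_Archimedean2 by blast
    have "norm (real (a n) / real n - L) < e" if n: "n \<ge> max m (max 1 N)" for n
    proof -
      have n1: "n \<ge> 1" "n \<ge> m" "n \<ge> N" using n by auto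
      have "L \<le> real (a n) / real n" unfolding L_def using bdd n1 by (intro cINF_lower) auto
      moreover have "real (a n) / real n < L + e"
      proof -
        have q: "n div m > 0" using n1 m by (simp add: div_greater_zero_iff)
        have "a n \<le> a (n div m * m) + a (n mod m)" using sub[of "n div m * m" "n mod m"] by simp
        also have "\<dots> \<le> n div m * a m + C" using mult[OF q] C[of "n mod m"] m by (intro add_mono) auto
        finally have "real (a n) \<le> real (n div m) * real (a m) + real C"
          by (metis of_nat_add of_nat_le_iff of_nat_mult)
        also have "real (n div m) * real (a m) \<le> real n / real m * real (a m)"
        proof (rule mult_right_mono)
          have "real (n div m) * real m \<le> real n"
            by (metis div_times_less_eq_dividend of_nat_le_iff of_nat_mult)
          then show "real (n div m) \<le> real n / real m" using m by (simp add: pos_le_divide_eq)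
        qed simp
        finally have "real (a n) / real n \<le> real (a m) / real m + real C / real n"
          using n1 m by (simp add: field_simps)
        moreover have "real C / real n < e / 2"
        proof -
          have "real C / (e / 2) < real n" using N n1 by linarith
          then show ?thesis using e n1 by (simp add: field_simps)
        qed
        ultimately show ?thesis using m(2) by linarith
      qed
      ultimately show ?thesis by simp
    qed
    then show "\<exists>no. \<forall>n\<ge>no. norm (real (a n) / real n - L) < e" by blast
  qed
  then show ?thesis by (rule convergentI)
qed

text \<open>The constant \<open>lim\<close> is meaningful only for a convergent sequence, so a lower bound for all terms
  bounds the mean dimension only after subadditivity has shown convergence.\<close>

lemma mdim_pos:
  assumes X: "tds X T" "topspace X \<noteq> {}" and \<U>: "finite_open_cover X \<U>" and c: "c > 0"
    and ge: "\<And>n. n \<ge> 1 \<Longrightarrow> c * real n \<le> real (cover_D X (cover_iter X T \<U> n))"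
  shows "0 < mdim X T"
proof -
  have met: "metrizable_space X" and T: "continuous_map X X T"
    using X(1) homeomorphic_imp_continuous_map by (auto simp: tds_def)
  have "convergent (\<lambda>n. real (cover_D X (cover_iter X T \<U> n)) / real n)"
  proof (rule convergent_subadditive)
    fix m n
    note cov = finite_open_cover_iter[OF \<U> T]
    have "cover_D X (cover_iter X T \<U> (m + n))
        \<le> cover_D X (cover_iter X T \<U> m) + cover_D X (cover_pullback X T m (cover_iter X T \<U> n))"
      unfolding cover_iter_add[OF \<U> T]
      by (intro cover_D_join_le met X cov finite_open_cover_pullback T)
    also have "\<dots> \<le> cover_D X (cover_iter X T \<U> m) + cover_D X (cover_iter X T \<U> n)"
      using cover_D_pullback_le[OF X(2) cov T] by simp
    finally show "cover_D X (cover_iter X T \<U> (m + n))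
        \<le> cover_D X (cover_iter X T \<U> m) + cover_D X (cover_iter X T \<U> n)" .
  qed
  then have "(\<lambda>n. real (cover_D X (cover_iter X T \<U> n)) / real n) \<longlonglongrightarrow> mdim_cover X T \<U>"
    by (simp add: mdim_cover_def convergent_LIMSEQ_iff)
  then have "c \<le> mdim_cover X T \<U>"
    by (rule LIMSEQ_le_const) (use ge in \<open>auto intro!: exI[of _ 1] simp: pos_le_divide_eq\<close>)
  with c have "0 < ereal (mdim_cover X T \<U>)" by simp
  also have "\<dots> \<le> mdim X T"
    unfolding mdim_def using \<U> by (intro SUP_upper) auto
  finally show ?thesis .
qed

section \<open>Cubes in a system and recurrence\<close>

lemma mem_cover_iterD:
  assumes "W \<in> cover_iter X T \<U> n" "i < n"
  shows "\<exists>U\<in>\<U>. W \<subseteq> {x \<in> topspace X. (T ^^ i) x \<in> U}"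
  using assms
proof (induction n arbitrary: W)
  case (Suc n)
  then obtain A U where A: "A \<in> cover_iter X T \<U> n" and U: "U \<in> \<U>"
    and W: "W = A \<inter> {x \<in> topspace X. (T ^^ n) x \<in> U}"
    by (auto simp: mem_cover_join_iff cover_pullback_def)
  show ?case
  proof (cases "i = n")
    case True
    then show ?thesis using U W by blast
  next
    case False
    then obtain U' where "U' \<in> \<U>" "A \<subseteq> {x \<in> topspace X. (T ^^ i) x \<in> U'}"
      using Suc.IH[OF A] Suc.prems(2) by auto
    then show ?thesis using W by blast
  qed
qed simp

text \<open>A \<open>k\<close>-cube in \<open>Q\<close>, opposite faces of which are told apart by \<open>{U\<^sub>0, U\<^sub>1}\<close> at \<open>k\<close> times before
  \<open>n\<close>, forces the dimension of the \<open>n\<close>-fold join up to \<open>k\<close>: a member of a refinement of the join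
  cannot meet opposite faces, so the covering theorem applies to the pulled back cover.\<close>

lemma cube_le_cover_D_iter:
  fixes \<Psi> :: "(nat \<Rightarrow> real) \<Rightarrow> 'q"
  assumes Q: "metrizable_space Q" and S: "continuous_map Q Q S"
    and cover: "finite_open_cover Q {U\<^sub>0, U\<^sub>1}"
    and \<Psi>: "continuous_map (top_of_set hcube) Q \<Psi>"
    and e: "\<And>l. l < k \<Longrightarrow> e l < n"
    and face0: "\<And>l s. \<lbrakk>l < k; s \<in> hcube; s l = 0\<rbrakk> \<Longrightarrow> (S ^^ e l) (\<Psi> s) \<notin> U\<^sub>1"
    and face1: "\<And>l s. \<lbrakk>l < k; s \<in> hcube; s l = 1\<rbrakk> \<Longrightarrow> (S ^^ e l) (\<Psi> s) \<notin> U\<^sub>0"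
  shows "k \<le> cover_D Q (cover_iter Q S {U\<^sub>0, U\<^sub>1} n)"
proof -
  obtain \<gamma> where \<gamma>: "finite_open_cover Q \<gamma>" "refines \<gamma> (cover_iter Q S {U\<^sub>0, U\<^sub>1} n)"
      "cover_ord Q \<gamma> = cover_D Q (cover_iter Q S {U\<^sub>0, U\<^sub>1} n)"
    using cover_D_attained[OF finite_open_cover_iter[OF cover S]] .
  obtain f where f: "\<And>V. V \<in> \<gamma> \<Longrightarrow> continuous_map Q euclideanreal (f V)"
    "\<And>V x. \<lbrakk>V \<in> \<gamma>; x \<in> topspace Q\<rbrakk> \<Longrightarrow> 0 \<le> f V x"
    "\<And>V x. \<lbrakk>V \<in> \<gamma>; x \<in> topspace Q\<rbrakk> \<Longrightarrow> 0 < f V x \<longleftrightarrow> x \<in> V"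
    "\<And>x. x \<in> topspace Q \<Longrightarrow> (\<Sum>V\<in>\<gamma>. f V x) = 1"
    using partition_of_unity[OF Q \<gamma>(1)] by blast
  note fin = finite_open_coverD(1)[OF \<gamma>(1)]
  have \<Psi>_in: "\<Psi> s \<in> topspace Q" if "s \<in> hcube" for s
    using continuous_map_funspace[OF \<Psi>] that by auto
  have "\<exists>s\<in>hcube. k < card {V \<in> \<gamma>. f V (\<Psi> s) > 0}"
  proof (rule cube_covering_theorem[OF fin])
    show "continuous_on hcube (\<lambda>s. f V (\<Psi> s))" if "V \<in> \<gamma>" for V
      using continuous_map_compose[OF \<Psi> f(1)[OF that]] by (simp add: o_def)
    show "0 \<le> f V (\<Psi> s)" if "V \<in> \<gamma>" "s \<in> hcube" for V s
      using f(2)[OF that(1) \<Psi>_in[OF that(2)]] .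
    show "(\<Sum>V\<in>\<gamma>. f V (\<Psi> s)) = 1" if "s \<in> hcube" for s
      using f(4)[OF \<Psi>_in[OF that]] .
    fix V l s t
    assume V: "V \<in> \<gamma>" and l: "l < k" and s: "s \<in> hcube" "s l = 0" and t: "t \<in> hcube" "t l = 1"
      and pos: "f V (\<Psi> s) > 0" "f V (\<Psi> t) > 0"
    have mem: "\<Psi> s \<in> V" "\<Psi> t \<in> V"
      using pos f(3)[OF V \<Psi>_in] s(1) t(1) by blast+
    obtain W where W: "W \<in> cover_iter Q S {U\<^sub>0, U\<^sub>1} n" "V \<subseteq> W"
      using \<gamma>(2) V unfolding refines_def by blast
    obtain U where "U \<in> {U\<^sub>0, U\<^sub>1}" "W \<subseteq> {x \<in> topspace Q. (S ^^ e l) x \<in> U}"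
      using mem_cover_iterD[OF W(1) e[OF l]] by blast
    with mem W(2) have "U = U\<^sub>0 \<or> U = U\<^sub>1" "(S ^^ e l) (\<Psi> s) \<in> U" "(S ^^ e l) (\<Psi> t) \<in> U"
      by blast+
    then show False using face0[OF l s] face1[OF l t] by blast
  qed
  then obtain s where s: "s \<in> hcube" "k < card {V \<in> \<gamma>. f V (\<Psi> s) > 0}" by blast
  have "{V \<in> \<gamma>. f V (\<Psi> s) > 0} = {V \<in> \<gamma>. \<Psi> s \<in> V}"
    using f(3)[OF _ \<Psi>_in[OF s(1)]] by blast
  then show ?thesis
    using card_members_le_cover_ord[OF fin \<Psi>_in[OF s(1)]] s(2) \<gamma>(3) by simp
qed

text \<open>The cover consists of the complements of disjoint closed neighbourhoods of the two points.\<close>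

lemma separating_two_set_cover:
  assumes X: "metrizable_space X" and q: "q\<^sub>0 \<in> topspace X" "q\<^sub>1 \<in> topspace X" "q\<^sub>0 \<noteq> q\<^sub>1"
  obtains U\<^sub>0 U\<^sub>1 G\<^sub>0 G\<^sub>1 where "finite_open_cover X {U\<^sub>0, U\<^sub>1}"
    "openin X G\<^sub>0" "q\<^sub>0 \<in> G\<^sub>0" "G\<^sub>0 \<inter> U\<^sub>1 = {}" "openin X G\<^sub>1" "q\<^sub>1 \<in> G\<^sub>1" "G\<^sub>1 \<inter> U\<^sub>0 = {}"
proof -
  have base: "\<exists>G K. openin X G \<and> closedin X K \<and> x \<in> G \<and> G \<subseteq> K \<and> K \<subseteq> W"
    if "openin X W" "x \<in> W" for W x
    using metrizable_imp_regular_space[OF X] that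
    unfolding neighbourhood_base_of_closedin[symmetric] neighbourhood_base_of by blast
  have "closedin X {q\<^sub>1}"
    using metrizable_imp_t1_space[OF X] q by (simp add: t1_space_closedin_singleton)
  then have "openin X (topspace X - {q\<^sub>1})" by blast
  from base[OF this, of q\<^sub>0] obtain G\<^sub>0 K\<^sub>0 where 0: "openin X G\<^sub>0" "closedin X K\<^sub>0" "q\<^sub>0 \<in> G\<^sub>0"
    "G\<^sub>0 \<subseteq> K\<^sub>0" "K\<^sub>0 \<subseteq> topspace X - {q\<^sub>1}" using q by blast
  have "openin X (topspace X - K\<^sub>0)" using 0(2) by blast
  from base[OF this, of q\<^sub>1] obtain G\<^sub>1 K\<^sub>1 where 1: "openin X G\<^sub>1" "closedin X K\<^sub>1" "q\<^sub>1 \<in> G\<^sub>1"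
    "G\<^sub>1 \<subseteq> K\<^sub>1" "K\<^sub>1 \<subseteq> topspace X - K\<^sub>0" using q 0(5) by blast
  show thesis
  proof (rule that[of "topspace X - K\<^sub>1" "topspace X - K\<^sub>0" G\<^sub>0 G\<^sub>1])
    show "finite_open_cover X {topspace X - K\<^sub>1, topspace X - K\<^sub>0}"
      using 0(2) 1(2,5) unfolding finite_open_cover_def by (simp add: closedin_def) blast
  qed (use 0 1 in blast)+
qed

text \<open>By invariance the number of visits to \<open>C\<close> before time \<open>n\<close> has mean \<open>n \<mu>(C)\<close>, and it is at least
  its mean somewhere. The point may depend on \<open>n\<close>, which spares any ergodic theorem.\<close>

lemma frequent_visits:
  assumes \<mu>: "borel_prob_measure_on Y \<mu>" and inv: "invariant_measure \<mu> T"
    and T: "continuous_map Y Y T" and C: "openin Y C"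
  obtains x where "x \<in> topspace Y" "real n * measure \<mu> C \<le> real (card {i. i < n \<and> (T ^^ i) x \<in> C})"
proof -
  interpret prob_space \<mu> using \<mu> by (simp add: borel_prob_measure_on_def)
  have sp: "space \<mu> = topspace Y" and sets: "sets \<mu> = sets (sigma (topspace Y) {U. openin Y U})"
    using \<mu> by (auto simp: borel_prob_measure_on_def)
  have "{U. openin Y U} \<subseteq> Pow (topspace Y)" by (auto dest: openin_subset)
  then have open_sets: "U \<in> sets \<mu>" if "openin Y U" for U
    unfolding sets using that by (auto simp: sets_measure_of)
  define D where "D i = {x \<in> topspace Y. (T ^^ i) x \<in> C}" for i
  have D_open: "openin Y (D i)" for i
    unfolding D_def using continuous_map_funpow[OF T] C by (rule openin_continuous_map_preimage)
  have D_measure: "emeasure \<mu> (D i) = emeasure \<mu> C" for i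
  proof (induction i)
    case 0
    have "D 0 = C" using openin_subset[OF C] by (auto simp: D_def)
    then show ?case by simp
  next
    case (Suc i)
    have "D (Suc i) = T -` D i \<inter> space \<mu>"
      using continuous_map_funspace[OF T] by (auto simp: D_def sp funpow_swap1)
    then show ?case
      using inv open_sets[OF D_open] Suc by (simp add: invariant_measure_def)
  qed
  define N where "N x = card {i. i < n \<and> (T ^^ i) x \<in> C}" for x
  have "N x \<le> n" for x
    unfolding N_def using card_mono[of "{..<n}" "{i. i < n \<and> (T ^^ i) x \<in> C}"] by auto
  then have "N ` topspace Y \<subseteq> {..n}" by auto
  then have fin: "finite (N ` topspace Y)" by (rule finite_subset) simp
  have ne: "N ` topspace Y \<noteq> {}" using not_empty sp by auto
  then obtain x where x: "x \<in> topspace Y" "N x = Max (N ` topspace Y)"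
    using Max_in[OF fin ne] by auto
  have N_eq: "real (N y) = (\<Sum>i<n. indicator (D i) y)" if "y \<in> topspace Y" for y
  proof -
    have "{i. i < n \<and> (T ^^ i) y \<in> C} = {i \<in> {..<n}. y \<in> D i}" using that by (auto simp: D_def)
    then show ?thesis
      by (simp add: N_def indicator_def sum.If_cases Int_def)
  qed
  have int: "integrable \<mu> (\<lambda>y. indicator (D i) y :: real)" for i
    using open_sets[OF D_open] by (simp add: emeasure_eq_measure)
  have "real n * measure \<mu> C = (\<Sum>i<n. measure \<mu> (D i))"
    using D_measure by (simp add: measure_def)
  also have "\<dots> = (\<integral>y. (\<Sum>i<n. indicator (D i) y) \<partial>\<mu>)"
    using int open_sets[OF D_open] by (simp add: Bochner_Integration.integral_sum)
  also have "\<dots> \<le> real (N x)"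
  proof (rule integral_le_const)
    show "integrable \<mu> (\<lambda>y. \<Sum>i<n. indicator (D i) y :: real)"
      using int by (intro Bochner_Integration.integrable_sum)
    show "AE y in \<mu>. (\<Sum>i<n. indicator (D i) y) \<le> real (N x)"
    proof (rule AE_I2)
      fix y assume "y \<in> space \<mu>"
      then have y: "y \<in> topspace Y" by (simp add: sp)
      then have "N y \<le> N x" unfolding x(2) using fin by (intro Max_ge) auto
      then show "(\<Sum>i<n. indicator (D i) y) \<le> real (N x)" unfolding N_eq[OF y, symmetric] by simp
    qed
  qed
  finally show thesis using that x(1) by (simp add: N_def)
qed

lemma residue_class_pigeonhole:
  fixes A :: "nat set"
  assumes fin: "finite A" and L: "L > 0"
  obtains r where "real (card A) / real L \<le> real (card {i \<in> A. i mod L = r})"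
proof -
  have "\<exists>r<L. real (card A) / real L \<le> real (card {i \<in> A. i mod L = r})"
  proof (rule ccontr)
    assume "\<not> ?thesis"
    then have less: "real (card {i \<in> A. i mod L = r}) < real (card A) / real L" if "r < L" for r
      using that by (meson not_le)
    have "(\<Sum>r<L. card {i \<in> A. i mod L = r}) = card A"
      using sum.group[OF fin, of "{..<L}" "\<lambda>i. i mod L" "\<lambda>_. 1::nat"] L by (auto simp: image_subset_iff)
    then have "real (card A) = (\<Sum>r<L. real (card {i \<in> A. i mod L = r}))"
      by (metis of_nat_sum)
    also have "\<dots> < (\<Sum>r<L. real (card A) / real L)"
      using less L by (intro sum_strict_mono) auto
    also have "\<dots> = real (card A)" using L by simp
    finally show False by simp
  qed
  then show thesis using that by blast
qed

section \<open>Factors of the hub-and-spoke system\<close>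

definition unshift :: "(int \<Rightarrow> 'a) \<Rightarrow> int \<Rightarrow> 'a" where
  "unshift y = (\<lambda>m. y (m - 1))"

lemma shift_unshift [simp]: "shift (unshift y) = y" "unshift (shift y) = y"
  by (simp_all add: shift_def unshift_def)

lemma funpow_shift: "(shift ^^ i) y = (\<lambda>m. y (m + int i))"
  by (induction i) (auto simp: shift_def algebra_simps)

lemma homeomorphic_map_shift:
  "homeomorphic_map (product_topology (\<lambda>_. A) UNIV) (product_topology (\<lambda>_. A) UNIV) shift"
proof -
  have "homeomorphic_maps (product_topology (\<lambda>_. A) UNIV) (product_topology (\<lambda>_. A) UNIV) shift unshift"
    unfolding homeomorphic_maps_def
  proof (intro conjI)
    show "continuous_map (product_topology (\<lambda>_. A) UNIV) (product_topology (\<lambda>_. A) UNIV) shift"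
      unfolding continuous_map_componentwise_UNIV shift_def
      by (intro allI continuous_map_product_projection UNIV_I)
    show "continuous_map (product_topology (\<lambda>_. A) UNIV) (product_topology (\<lambda>_. A) UNIV) unshift"
      unfolding continuous_map_componentwise_UNIV unshift_def
      by (intro allI continuous_map_product_projection UNIV_I)
  qed auto
  then show ?thesis unfolding homeomorphic_map_maps by blast
qed

text \<open>A basic open set of a product constrains finitely many coordinates.\<close>

lemma openin_product_agree_on_window:
  fixes Z :: "(int \<Rightarrow> 'a) set"
  assumes U: "openin (subtopology (product_topology (\<lambda>_. A) UNIV) Z) U" and y: "y \<in> U"
    and Z: "Z \<subseteq> topspace (product_topology (\<lambda>_. A) UNIV)"
  shows "\<exists>M::nat. \<forall>z\<in>Z. (\<forall>j. \<bar>j\<bar> \<le> int M \<longrightarrow> z j = y j) \<longrightarrow> z \<in> U"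
proof -
  obtain U' where U': "openin (product_topology (\<lambda>_. A) UNIV) U'" "U = U' \<inter> Z"
    using U unfolding openin_subtopology by blast
  obtain B where B: "y \<in> PiE UNIV B" "finite {j. B j \<noteq> topspace A}" "PiE UNIV B \<subseteq> U'"
    using product_topology_open_contains_basis[OF U'(1), of y] y U'(2) by auto
  obtain M where M: "M \<ge> Max (insert 0 ((\<lambda>j. nat \<bar>j\<bar>) ` {j. B j \<noteq> topspace A}))" by blast
  show ?thesis
  proof (intro exI[of _ M] ballI impI)
    fix z assume z: "z \<in> Z" "\<forall>j. \<bar>j\<bar> \<le> int M \<longrightarrow> z j = y j"
    have "z j \<in> B j" for j
    proof (cases "B j = topspace A")
      case True
      then show ?thesis using z(1) Z by (auto simp: PiE_iff)
    next
      case False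
      then have "nat \<bar>j\<bar> \<le> M" using M B(2) by simp
      then have "z j = y j" using z(2) by simp
      then show ?thesis using B(1) by (auto simp: PiE_iff)
    qed
    then show "z \<in> U" using B(3) U'(2) z(1) by (auto simp: PiE_iff)
  qed
qed

lemma openin_cylinder:
  assumes X: "X \<subseteq> topspace (full_shift_top a)" and w: "w \<in> X"
  shows "openin (subtopology (full_shift_top a) X) {x \<in> X. \<forall>j. \<bar>j\<bar> \<le> int M \<longrightarrow> x j = w j}"
proof -
  let ?B = "\<lambda>j. if \<bar>j\<bar> \<le> int M then {w j} else {1..a}"
  have letters: "x j \<in> {1..a}" if "x \<in> X" for x j
    using X that by (auto simp: full_shift_top_def PiE_iff)
  have "{j. ?B j \<noteq> {1..a}} \<subseteq> {- int M..int M}" by auto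
  then have "finite {j. ?B j \<noteq> {1..a}}" by (rule finite_subset) simp
  then have "openin (full_shift_top a) (PiE UNIV ?B)"
    unfolding full_shift_top_def openin_PiE_gen using letters[OF w] by auto
  moreover have "x \<in> PiE UNIV ?B \<longleftrightarrow> (\<forall>j. \<bar>j\<bar> \<le> int M \<longrightarrow> x j = w j)" if "x \<in> X" for x
    using letters[OF that] by (auto simp: PiE_iff)
  then have "{x \<in> X. \<forall>j. \<bar>j\<bar> \<le> int M \<longrightarrow> x j = w j} = PiE UNIV ?B \<inter> X" by blast
  ultimately show ?thesis unfolding openin_subtopology by blast
qed

lemma spoke_map_in_disk:
  assumes "\<And>j. norm (p (x j)) \<le> 1" "\<And>j. t j \<in> {0..1}"
  shows "spoke_map p x t \<in> topspace disk_shift_top"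
proof -
  have "\<bar>t j\<bar> * norm (p (x j)) \<le> 1" for j
    using mult_mono[of "\<bar>t j\<bar>" 1 "norm (p (x j))" 1] assms(1)[of j] assms(2)[of j] by auto
  then show ?thesis by (simp add: disk_shift_top_def spoke_map_def PiE_iff)
qed

lemma shift_mem_Spoke_iff:
  assumes X: "shift ` X = X"
  shows "shift y \<in> Spoke p X \<longleftrightarrow> y \<in> Spoke p X"
proof
  assume "y \<in> Spoke p X"
  then obtain x t where "x \<in> X" "\<forall>i. t i \<in> {0..1}" "y = spoke_map p x t"
    by (auto simp: Spoke_def)
  moreover from this have "shift y = spoke_map p (shift x) (shift t)"
    by (simp add: spoke_map_def shift_def)
  moreover have "shift x \<in> X" using X \<open>x \<in> X\<close> by blast
  ultimately show "shift y \<in> Spoke p X"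
    unfolding Spoke_def by (auto simp: shift_def intro!: exI[of _ "shift x"] exI[of _ "shift t"])
next
  assume "shift y \<in> Spoke p X"
  then obtain x t where xt: "x \<in> X" "\<forall>i. t i \<in> {0..1}" "shift y = spoke_map p x t"
    by (auto simp: Spoke_def)
  have "y = unshift (spoke_map p x t)" using xt(3) by (metis shift_unshift(2))
  then have "y = spoke_map p (unshift x) (unshift t)"
    by (simp add: spoke_map_def unshift_def)
  moreover have "unshift x \<in> X" using X xt(1) by (metis imageE shift_unshift(2))
  moreover have "\<forall>i. unshift t i \<in> {0..1}" using xt(2) by (simp add: unshift_def)
  ultimately show "y \<in> Spoke p X" unfolding Spoke_def by blast
qed

lemma compactin_Spoke:
  assumes p: "p ` {1..a} \<subseteq> cball 0 1" and X: "closedin (full_shift_top a) X"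
  shows "compactin disk_shift_top (Spoke p X)"
proof -
  let ?T = "product_topology (\<lambda>_::int. top_of_set {0..1::real}) UNIV"
  let ?P = "prod_topology (subtopology (full_shift_top a) X) ?T"
  have topX: "topspace (subtopology (full_shift_top a) X) = X"
    using closedin_subset[OF X] by auto
  have letters: "x j \<in> {1..a}" if "x \<in> X" for x j
    using closedin_subset[OF X] that by (auto simp: full_shift_top_def PiE_iff)
  have "compact_space (full_shift_top a)"
    by (simp add: full_shift_top_def compact_space_product_topology compact_space_discrete_topology)
  then have "compact_space (subtopology (full_shift_top a) X)"
    using X closedin_compact_space compact_space_subtopology by blast
  moreover have "compact_space ?T"
    by (simp add: compact_space_product_topology compact_space_subtopology)
  ultimately have P: "compactin ?P (topspace ?P)"
    unfolding compact_space_def[symmetric] compact_space_prod_topology by blast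
  have "continuous_map ?P euclidean (\<lambda>z. snd z j *\<^sub>R p (fst z j))" for j
  proof -
    have "continuous_map (full_shift_top a) (discrete_topology {1..a}) (\<lambda>x. x j)"
      unfolding full_shift_top_def by (rule continuous_map_product_projection) simp
    then have "continuous_map (full_shift_top a) euclidean (p \<circ> (\<lambda>x. x j))"
      by (rule continuous_map_compose) simp
    then have "continuous_map (subtopology (full_shift_top a) X) euclidean (\<lambda>x. p (x j))"
      by (simp add: o_def continuous_map_from_subtopology)
    from continuous_map_compose[OF continuous_map_fst this]
    have 1: "continuous_map ?P euclidean (\<lambda>z. p (fst z j))" by (simp add: o_def)
    have "continuous_map ?T euclidean (\<lambda>t. t j)"
      using continuous_map_product_projection[of j UNIV "\<lambda>_. top_of_set {0..1::real}"]
      by (simp add: continuous_map_in_subtopology)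
    from continuous_map_compose[OF continuous_map_snd this]
    have 2: "continuous_map ?P euclidean (\<lambda>z. snd z j)" by (simp add: o_def)
    show ?thesis using 1 2 by (simp add: continuous_map_atin tendsto_scaleR)
  qed
  moreover have "(\<lambda>z. spoke_map p (fst z) (snd z)) z \<in> topspace disk_shift_top" if z: "z \<in> topspace ?P" for z
  proof (rule spoke_map_in_disk)
    have "fst z \<in> X" using z topX by auto
    from letters[OF this] show "norm (p (fst z j)) \<le> 1" for j using p by force
    show "snd z j \<in> {0..1}" for j using z by (auto simp: PiE_iff)
  qed
  ultimately have "continuous_map ?P disk_shift_top (\<lambda>z. spoke_map p (fst z) (snd z))"
    unfolding disk_shift_top_def continuous_map_componentwise_UNIV continuous_map_in_subtopology
    by (auto simp: spoke_map_def PiE_iff)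
  from image_compactin[OF P this]
  have "compactin disk_shift_top ((\<lambda>z. spoke_map p (fst z) (snd z)) ` topspace ?P)" .
  also have "(\<lambda>z. spoke_map p (fst z) (snd z)) ` topspace ?P = Spoke p X"
    unfolding Spoke_def topspace_prod_topology topX by (force simp: PiE_iff image_iff)
  finally show ?thesis .
qed

lemma tds_Spoke:
  assumes p: "p ` {1..a} \<subseteq> cball 0 1" and X: "closedin (full_shift_top a) X"
    and inv: "shift ` X = X"
  shows "tds (subtopology disk_shift_top (Spoke p X)) shift"
  unfolding tds_def
proof (intro conjI)
  show "compact_space (subtopology disk_shift_top (Spoke p X))"
    using compactin_Spoke[OF p X] by (rule compact_space_subtopology)
  show "metrizable_space (subtopology disk_shift_top (Spoke p X))"
    unfolding disk_shift_top_def
    by (intro metrizable_space_subtopology)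
      (auto simp: metrizable_space_product_topology metrizable_space_subtopology metrizable_space_euclidean)
  show "homeomorphic_map (subtopology disk_shift_top (Spoke p X)) (subtopology disk_shift_top (Spoke p X)) shift"
    unfolding disk_shift_top_def
    by (rule homeomorphic_map_subtopologies_alt[OF homeomorphic_map_shift])
      (simp add: shift_mem_Spoke_iff[OF inv])
qed

lemma funpow_factor:
  assumes "\<And>x. x \<in> A \<Longrightarrow> \<phi> (T x) = S (\<phi> x)" "\<And>x. x \<in> A \<Longrightarrow> T x \<in> A" "x \<in> A"
  shows "\<phi> ((T ^^ i) x) = (S ^^ i) (\<phi> x)"
proof -
  have "(T ^^ i) x \<in> A \<and> \<phi> ((T ^^ i) x) = (S ^^ i) (\<phi> x)"
    by (induction i) (use assms in auto)
  then show ?thesis by blast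
qed

lemma equal_mod_separated:
  fixes m n L :: nat
  assumes "m mod L = n mod L" "m \<noteq> n"
  shows "int L \<le> \<bar>int m - int n\<bar>"
proof -
  have "int L dvd int m - int n"
    using assms(1) by (metis mod_eq_dvd_iff of_nat_mod)
  moreover have "int m - int n \<noteq> 0" using assms(2) by simp
  ultimately show ?thesis using dvd_imp_le_int[of "int m - int n" "int L"] by simp
qed

text \<open>Some point has an image other than that of the hub, the constant sequence 0, and by continuity
  so has a point \<open>y\<^sub>0\<close> supported on a finite window. For each \<open>n\<close> there is a point of \<open>X\<close> at
  which the letters under \<open>y\<^sub>0\<close> recur with frequency at least \<open>\<mu>(C)\<close>; keeping the recurrences in
  one residue class makes the windows disjoint. On each window the hub and \<open>y\<^sub>0\<close> are joined by
  scaling, independently of the other windows. This is a cube of dimension proportional to \<open>n\<close>.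
  Scaling factors 0 and 1 at one window are told apart in the factor at the corresponding time,
  whatever happens elsewhere.\<close>

lemma mdim_Spoke_factor_pos:
  fixes p :: "nat \<Rightarrow> real ^ 2" and X :: "(int \<Rightarrow> nat) set" and Q :: "'q topology"
  assumes p: "p ` {1..a} \<subseteq> cball 0 1"
    and X: "closedin (full_shift_top a) X" "shift ` X = X"
    and \<mu>: "borel_prob_measure_on (subtopology (full_shift_top a) X) \<mu>"
      "invariant_measure \<mu> shift" "full_support (subtopology (full_shift_top a) X) \<mu>"
    and factor: "tds_factor (subtopology disk_shift_top (Spoke p X)) shift Q S \<phi>"
    and nontrivial: "q \<in> topspace Q" "q' \<in> topspace Q" "q \<noteq> q'"
  shows "0 < mdim Q S"
proof -
  define Y where "Y = subtopology disk_shift_top (Spoke p X)"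
  have letters: "x j \<in> {1..a}" if "x \<in> X" for x j
    using closedin_subset[OF X(1)] that by (auto simp: full_shift_top_def PiE_iff)
  have topX: "topspace (subtopology (full_shift_top a) X) = X"
    using closedin_subset[OF X(1)] by auto
  have shiftX: "continuous_map (subtopology (full_shift_top a) X) (subtopology (full_shift_top a) X) shift"
    using X(2) homeomorphic_imp_continuous_map[OF homeomorphic_map_shift]
    unfolding full_shift_top_def continuous_map_in_subtopology
    by (auto intro: continuous_map_from_subtopology)
  have SpokeI: "spoke_map p x t \<in> Spoke p X" if "x \<in> X" "\<And>i. t i \<in> {0..1}" for x t
    using that unfolding Spoke_def by blast
  have sub: "Spoke p X \<subseteq> topspace disk_shift_top"
    using compactin_subset_topspace[OF compactin_Spoke[OF p X(1)]] .
  have topY: "topspace Y = Spoke p X" using sub by (auto simp: Y_def)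
  have Q: "tds Q S" and \<phi>: "continuous_map Y Q \<phi>" "\<phi> ` Spoke p X = topspace Q"
    and equivariant: "\<And>y. y \<in> Spoke p X \<Longrightarrow> \<phi> (shift y) = S (\<phi> y)"
    using factor topY unfolding tds_factor_def Y_def by auto
  have Qmet: "metrizable_space Q" and S: "continuous_map Q Q S"
    using Q homeomorphic_imp_continuous_map by (auto simp: tds_def)
  have \<phi>_iter: "\<phi> ((shift ^^ i) y) = (S ^^ i) (\<phi> y)" if "y \<in> Spoke p X" for i y
    using equivariant shift_mem_Spoke_iff[OF X(2)] that by (intro funpow_factor[where A = "Spoke p X"]) auto
  have shift_Spoke: "(shift ^^ i) y \<in> Spoke p X" if "y \<in> Spoke p X" for i y
    using that by (induction i) (auto simp: shift_mem_Spoke_iff[OF X(2)])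
  have window: "\<exists>M::nat. \<forall>z\<in>Spoke p X. (\<forall>j. \<bar>j\<bar> \<le> int M \<longrightarrow> z j = y j) \<longrightarrow> \<phi> z \<in> G"
    if G: "openin Q G" and y: "y \<in> Spoke p X" "\<phi> y \<in> G" for G y
  proof -
    have "openin Y {z \<in> Spoke p X. \<phi> z \<in> G}"
      using openin_continuous_map_preimage[OF \<phi>(1) G] by (simp add: topY)
    then show ?thesis
      using openin_product_agree_on_window[of _ "Spoke p X" "{z \<in> Spoke p X. \<phi> z \<in> G}" y] y sub
      unfolding Y_def disk_shift_top_def by auto
  qed

  define hub :: "int \<Rightarrow> real ^ 2" where "hub = (\<lambda>_. 0)"
  have "hub \<in> Spoke p X"
  proof -
    obtain x where "x \<in> X" using nontrivial(1) \<phi>(2) by (auto simp: Spoke_def)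
    then have "spoke_map p x (\<lambda>_. 0) \<in> Spoke p X" by (intro SpokeI) auto
    then show ?thesis by (simp add: hub_def spoke_map_def)
  qed
  then have hubQ: "\<phi> hub \<in> topspace Q" using \<phi>(2) by blast
  obtain y where y: "y \<in> Spoke p X" "\<phi> y \<noteq> \<phi> hub"
  proof -
    obtain z z' where "z \<in> Spoke p X" "q = \<phi> z" "z' \<in> Spoke p X" "q' = \<phi> z'"
      using nontrivial(1,2) \<phi>(2) by blast
    then show thesis using that nontrivial(3) by (cases "\<phi> z = \<phi> hub") auto
  qed
  have "closedin Q {\<phi> hub}"
    using metrizable_imp_t1_space[OF Qmet] hubQ by (simp add: t1_space_closedin_singleton)
  then have "openin Q (topspace Q - {\<phi> hub})" by blast
  moreover have "\<phi> y \<in> topspace Q - {\<phi> hub}" using y \<phi>(2) by blast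
  ultimately obtain N :: nat where
    N: "\<forall>z\<in>Spoke p X. (\<forall>j. \<bar>j\<bar> \<le> int N \<longrightarrow> z j = y j) \<longrightarrow> \<phi> z \<in> topspace Q - {\<phi> hub}"
    using window[OF _ y(1)] by blast
  obtain w t where w: "w \<in> X" and t: "\<And>i. t i \<in> {0..1}" and y_eq: "y = spoke_map p w t"
    using y(1) by (auto simp: Spoke_def)
  \<comment> \<open>Truncating \<open>t\<close> leaves \<open>y\<^sub>0\<close> depending on a finite part of \<open>w\<close> only, so that it can be
    planted wherever a point of \<open>X\<close> repeats that part.\<close>
  define t\<^sub>0 where "t\<^sub>0 j = (if \<bar>j\<bar> \<le> int N then t j else 0)" for j
  have t0: "t\<^sub>0 j \<in> {0..1}" for j using t by (auto simp: t\<^sub>0_def)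
  define y\<^sub>0 where "y\<^sub>0 = spoke_map p w t\<^sub>0"
  have y0: "y\<^sub>0 \<in> Spoke p X" unfolding y\<^sub>0_def using w t0 by (rule SpokeI)
  have "\<forall>j. \<bar>j\<bar> \<le> int N \<longrightarrow> y\<^sub>0 j = y j"
    by (simp add: y_eq y\<^sub>0_def spoke_map_def t\<^sub>0_def)
  then have "\<phi> y\<^sub>0 \<noteq> \<phi> hub" using N y0 by blast
  moreover have "\<phi> y\<^sub>0 \<in> topspace Q" using y0 \<phi>(2) by blast
  ultimately obtain U\<^sub>0 U\<^sub>1 G\<^sub>0 G\<^sub>1 where cover: "finite_open_cover Q {U\<^sub>0, U\<^sub>1}"
    and G0: "openin Q G\<^sub>0" "\<phi> hub \<in> G\<^sub>0" "G\<^sub>0 \<inter> U\<^sub>1 = {}"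
    and G1: "openin Q G\<^sub>1" "\<phi> y\<^sub>0 \<in> G\<^sub>1" "G\<^sub>1 \<inter> U\<^sub>0 = {}"
    using separating_two_set_cover[OF Qmet hubQ] by metis
  obtain M\<^sub>0 :: nat where
    M0: "\<forall>z\<in>Spoke p X. (\<forall>j. \<bar>j\<bar> \<le> int M\<^sub>0 \<longrightarrow> z j = hub j) \<longrightarrow> \<phi> z \<in> G\<^sub>0"
    using window[OF G0(1) \<open>hub \<in> Spoke p X\<close> G0(2)] by blast
  obtain M\<^sub>1 :: nat where
    M1: "\<forall>z\<in>Spoke p X. (\<forall>j. \<bar>j\<bar> \<le> int M\<^sub>1 \<longrightarrow> z j = y\<^sub>0 j) \<longrightarrow> \<phi> z \<in> G\<^sub>1"
    using window[OF G1(1) y0 G1(2)] by blast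
  \<comment> \<open>Agreement with the hub or with \<open>y\<^sub>0\<close> on the window of radius \<open>M\<close> forces the image into \<open>G\<^sub>0\<close> or
    \<open>G\<^sub>1\<close>, and the window contains the support of \<open>t\<^sub>0\<close>.\<close>
  define M where "M = max N (max M\<^sub>0 M\<^sub>1)"
  have near_hub: "\<phi> z \<notin> U\<^sub>1" if "z \<in> Spoke p X" "\<And>j. \<bar>j\<bar> \<le> int M \<Longrightarrow> z j = 0" for z
  proof -
    have "\<forall>j. \<bar>j\<bar> \<le> int M\<^sub>0 \<longrightarrow> z j = hub j" using that(2) by (simp add: M_def hub_def)
    then have "\<phi> z \<in> G\<^sub>0" using M0 that(1) by blast
    then show ?thesis using G0(3) by blast
  qed
  have near_y0: "\<phi> z \<notin> U\<^sub>0" if "z \<in> Spoke p X" "\<And>j. \<bar>j\<bar> \<le> int M \<Longrightarrow> z j = y\<^sub>0 j" for z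
  proof -
    have "\<forall>j. \<bar>j\<bar> \<le> int M\<^sub>1 \<longrightarrow> z j = y\<^sub>0 j" using that(2) by (simp add: M_def)
    then have "\<phi> z \<in> G\<^sub>1" using M1 that(1) by blast
    then show ?thesis using G1(3) by blast
  qed
  have t0_outside: "t\<^sub>0 j = 0" if "\<bar>j\<bar> > int M" for j
    using that by (auto simp: t\<^sub>0_def M_def)

  define C where "C = {x \<in> X. \<forall>j. \<bar>j\<bar> \<le> int M \<longrightarrow> x j = w j}"
  have C: "openin (subtopology (full_shift_top a) X) C"
    unfolding C_def using closedin_subset[OF X(1)] w by (rule openin_cylinder)
  have "w \<in> C" using w by (simp add: C_def)
  interpret prob_space \<mu> using \<mu>(1) by (simp add: borel_prob_measure_on_def)
  have "emeasure \<mu> C > 0" using \<mu>(3) C \<open>w \<in> C\<close> by (auto simp: full_support_def)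
  then have C_pos: "measure \<mu> C > 0" by (simp add: emeasure_eq_measure)
  \<comment> \<open>Distinct times that agree modulo \<open>L\<close> have disjoint windows of radius \<open>M\<close>.\<close>
  define L where "L = 2 * M + 1"
  have bound: "measure \<mu> C / real L * real n \<le> real (cover_D Q (cover_iter Q S {U\<^sub>0, U\<^sub>1} n))" for n
  proof -
    obtain x where "x \<in> topspace (subtopology (full_shift_top a) X)"
      and "real n * measure \<mu> C \<le> real (card {i. i < n \<and> (shift ^^ i) x \<in> C})"
      using frequent_visits[OF \<mu>(1,2) shiftX C, of n] .
    define V where "V = {i. i < n \<and> (shift ^^ i) x \<in> C}"
    have x: "x \<in> X" and V: "real n * measure \<mu> C \<le> real (card V)"
      using \<open>x \<in> topspace _\<close> \<open>real n * measure \<mu> C \<le> _\<close> topX by (simp_all add: V_def)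
    have "finite V" by (simp add: V_def)
    then obtain r where r: "real (card V) / real L \<le> real (card {i \<in> V. i mod L = r})"
      using residue_class_pigeonhole[of V L] by (auto simp: L_def)
    define I where "I = {i \<in> V. i mod L = r}"
    have "finite I" using \<open>finite V\<close> by (simp add: I_def)
    then obtain e where e: "bij_betw e {..<card I} I"
      using ex_bij_betw_nat_finite by (metis atLeast0LessThan)
    have eI: "e l \<in> I" if "l < card I" for l using bij_betwE[OF e] that by blast
    have visit: "x (j + int (e l)) = w j" if "l < card I" "\<bar>j\<bar> \<le> int M" for l j
      using eI[OF that(1)] that(2) by (simp add: I_def V_def C_def funpow_shift)
    have separated: "int L \<le> \<bar>int (e l) - int (e l')\<bar>" if "l < card I" "l' < card I" "l \<noteq> l'" for l l'
    proof (rule equal_mod_separated)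
      show "e l mod L = e l' mod L" using eI[OF that(1)] eI[OF that(2)] by (simp add: I_def)
      show "e l \<noteq> e l'" using bij_betw_imp_inj_on[OF e] that by (auto simp: inj_on_def)
    qed
    \<comment> \<open>The cube: \<open>t\<^sub>0\<close> is planted at each selected visit \<open>e l\<close>, scaled by \<open>s l\<close>. As the copies have
      disjoint windows, at most one summand is nonzero.\<close>
    define \<tau> where "\<tau> s j = (\<Sum>l<card I. s l * t\<^sub>0 (j - int (e l)))" for s :: "nat \<Rightarrow> real" and j
    have \<tau>_window: "\<tau> s (j + int (e l)) = s l * t\<^sub>0 j" if l: "l < card I" and j: "\<bar>j\<bar> \<le> int M" for s l j
    proof -
      have "s l' * t\<^sub>0 (j + int (e l) - int (e l')) = (if l' = l then s l * t\<^sub>0 j else 0)"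
        if "l' < card I" for l'
      proof (cases "l' = l")
        case False
        then have "t\<^sub>0 (j + int (e l) - int (e l')) = 0"
          using separated[OF l that] j by (intro t0_outside) (auto simp: L_def)
        then show ?thesis using False by simp
      qed simp
      then have "\<tau> s (j + int (e l)) = (\<Sum>l'<card I. if l' = l then s l * t\<^sub>0 j else 0)"
        unfolding \<tau>_def by (intro sum.cong) auto
      then show ?thesis using l by simp
    qed
    have \<tau>_unit: "\<tau> s j \<in> {0..1}" if s: "s \<in> hcube" for s j
    proof (cases "\<exists>l<card I. \<bar>j - int (e l)\<bar> \<le> int M")
      case True
      then obtain l where l: "l < card I" "\<bar>j - int (e l)\<bar> \<le> int M" by blast
      then have "\<tau> s j = s l * t\<^sub>0 (j - int (e l))" using \<tau>_window[of l "j - int (e l)" s] by simp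
      then show ?thesis
        using s t0[of "j - int (e l)"] by (auto simp: hcube_def intro: mult_le_one)
    next
      case False
      then have "t\<^sub>0 (j - int (e l)) = 0" if "l < card I" for l
        using that by (intro t0_outside) (meson not_le)
      then have "\<tau> s j = 0" unfolding \<tau>_def by (intro sum.neutral) simp
      then show ?thesis by simp
    qed
    have in_Spoke: "spoke_map p x (\<tau> s) \<in> Spoke p X" if "s \<in> hcube" for s
      using x \<tau>_unit[OF that] by (rule SpokeI)
    have "continuous_map (top_of_set hcube) Y (\<lambda>s. spoke_map p x (\<tau> s))"
      unfolding Y_def continuous_map_in_subtopology
    proof
      have "continuous_on hcube (\<lambda>s. \<tau> s j *\<^sub>R p (x j))" for j
        unfolding \<tau>_def
        by (intro continuous_intros continuous_on_subset[OF continuous_on_product_coordinates]) auto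
      moreover have "spoke_map p x (\<tau> s) j \<in> cball 0 1" if "s \<in> hcube" for s j
        using in_Spoke[OF that] sub by (auto simp: disk_shift_top_def PiE_iff simp del: mem_cball)
      ultimately show "continuous_map (top_of_set hcube) disk_shift_top (\<lambda>s. spoke_map p x (\<tau> s))"
        unfolding disk_shift_top_def continuous_map_componentwise_UNIV continuous_map_in_subtopology
        by (auto simp: spoke_map_def)
    qed (use in_Spoke in auto)
    from continuous_map_compose[OF this \<phi>(1)]
    have \<Psi>: "continuous_map (top_of_set hcube) Q (\<lambda>s. \<phi> (spoke_map p x (\<tau> s)))" by (simp add: o_def)
    have spoke_window: "(shift ^^ e l) (spoke_map p x (\<tau> s)) j = s l *\<^sub>R y\<^sub>0 j"
      if "l < card I" "\<bar>j\<bar> \<le> int M" for l s j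
      using \<tau>_window[OF that, of s] visit[OF that] by (simp add: funpow_shift spoke_map_def y\<^sub>0_def)
    have "card I \<le> cover_D Q (cover_iter Q S {U\<^sub>0, U\<^sub>1} n)"
    proof (rule cube_le_cover_D_iter[OF Qmet S cover \<Psi>])
      show "e l < n" if "l < card I" for l using eI[OF that] by (simp add: I_def V_def)
      show "(S ^^ e l) (\<phi> (spoke_map p x (\<tau> s))) \<notin> U\<^sub>1" if "l < card I" "s \<in> hcube" "s l = 0" for l s
        unfolding \<phi>_iter[OF in_Spoke[OF that(2)], symmetric]
        using spoke_window[OF that(1)] that(3) by (intro near_hub shift_Spoke in_Spoke that(2)) simp
      show "(S ^^ e l) (\<phi> (spoke_map p x (\<tau> s))) \<notin> U\<^sub>0" if "l < card I" "s \<in> hcube" "s l = 1" for l s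
        unfolding \<phi>_iter[OF in_Spoke[OF that(2)], symmetric]
        using spoke_window[OF that(1)] that(3) by (intro near_y0 shift_Spoke in_Spoke that(2)) simp
    qed
    have "measure \<mu> C / real L * real n \<le> real (card V) / real L"
      using divide_right_mono[OF V, of "real L"] by (simp add: mult.commute)
    also have "\<dots> \<le> real (card I)" using r by (simp add: I_def)
    also have "\<dots> \<le> real (cover_D Q (cover_iter Q S {U\<^sub>0, U\<^sub>1} n))"
      using \<open>card I \<le> _\<close> by simp
    finally show ?thesis .
  qed
  have "measure \<mu> C / real L > 0" using C_pos by (simp add: L_def)
  then show ?thesis
    using bound hubQ by (intro mdim_pos[OF Q _ cover]) auto
qed

theorem theorem1p4:
  fixes a :: nat
    and p :: "nat \<Rightarrow> real ^ 2"
    and X :: "(int \<Rightarrow> nat) set"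
  assumes "a \<ge> 1"
    and "inj_on p {1..a}" and "p ` {1..a} \<subseteq> sphere 0 1"
    and "closedin (full_shift_top a) X" and "shift ` X = X"
    and "\<exists>\<mu>. borel_prob_measure_on (subtopology (full_shift_top a) X) \<mu> \<and>
           invariant_measure \<mu> shift \<and> full_support (subtopology (full_shift_top a) X) \<mu>"
  shows "CPMD TYPE('q) (subtopology disk_shift_top (Spoke p X)) shift"
proof -
  have p: "p ` {1..a} \<subseteq> cball 0 1"
    using assms(3) sphere_cball by blast
  obtain \<mu> where \<mu>: "borel_prob_measure_on (subtopology (full_shift_top a) X) \<mu>"
      "invariant_measure \<mu> shift" "full_support (subtopology (full_shift_top a) X) \<mu>"
    using assms(6) by blast
  show ?thesis
    unfolding CPMD_def
  proof (intro conjI notI)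
    show "tds (subtopology disk_shift_top (Spoke p X)) shift"
      using tds_Spoke[OF p assms(4,5)] .
    assume "\<exists>(Q :: 'q topology) S \<phi>. tds_factor (subtopology disk_shift_top (Spoke p X)) shift Q S \<phi> \<and>
          (\<exists>x\<in>topspace Q. \<exists>y\<in>topspace Q. x \<noteq> y) \<and> mdim Q S = 0"
    then obtain Q :: "'q topology" and S \<phi> q q' where
      "tds_factor (subtopology disk_shift_top (Spoke p X)) shift Q S \<phi>"
      "q \<in> topspace Q" "q' \<in> topspace Q" "q \<noteq> q'" "mdim Q S = 0"
      by blast
    then show False using mdim_Spoke_factor_pos[OF p assms(4,5) \<mu>] by (metis less_irrefl)
  qed
qed

end
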